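(* Let $K\ge 1$ be an integer and let $Q(x)=\sum_{k=0}^Kq_kx^k$ be a polynomial with real coefficients, $q_K\neq0$. Let $v\in C^K(\mathbb{R})\cap L^\infty(\mathbb{R})$ satisfy $v(\xi)>0$ and $|v'(\xi)|\le Cv(\xi)$ for all $\xi\in\mathbb{R}$ and some constant $C$. Let $A$ be the self-adjoint operator $A=vQ(D)v$ in $L^2(\mathbb{R})$, $D=i\,d/d\xi$. Then $0$ is not an eigenvalue of the operator $A$.
   Context: The symmetric operator $A_0$ in $L^2(\mathbb{R})$ is defined on the domain $C_0^K(\mathbb{R})$ ($K$ times continuously differentiable functions with compact support) by $A_0g=vQ(D)(vg)$. Under the stated conditions on $v$ it is essentially self-adjoint, and $A$ denotes its closure; $\mathcal{D}(A)$ consists of all $g\in L^2(\mathbb{R})$ such that $vQ(D)(vg)$, understood in the sense of distributions, belongs to $L^2(\mathbb{R})$, and $Ag=vQ(D)(vg)$. *)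

theory Defs
  imports "HOL-Analysis.Analysis" "HOL-Computational_Algebra.Polynomial"
begin

definition nderiv :: "nat \<Rightarrow> (real \<Rightarrow> 'a::real_normed_vector) \<Rightarrow> real \<Rightarrow> 'a" where
  "nderiv k = (\<lambda>f x. vector_derivative f (at x)) ^^ k"

definition Ck :: "nat \<Rightarrow> (real \<Rightarrow> 'a::real_normed_vector) set" where
  "Ck k = {f. (\<forall>j<k. \<forall>x. nderiv j f differentiable (at x)) \<and> continuous_on UNIV (nderiv k f)}"

definition Ck_compact :: "nat \<Rightarrow> (real \<Rightarrow> 'a::real_normed_vector) set" where
  "Ck_compact k = {f \<in> Ck k. compact (closure {x. f x \<noteq> 0})}"

definition test_fun :: "(real \<Rightarrow> complex) set" where
  "test_fun = (\<Inter>k. Ck_compact k)"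


text \<open>The Hilbert space of square-integrable functions is represented by functions rather than by
  classes modulo null sets; operators are represented by their graphs, which may therefore relate a
  function to several almost everywhere equal ones.\<close>

definition L2 :: "(real \<Rightarrow> complex) set" where
  "L2 = {g \<in> borel_measurable lborel. integrable lborel (\<lambda>x. (cmod (g x))\<^sup>2)}"

definition L2_norm :: "(real \<Rightarrow> complex) \<Rightarrow> real" where
  "L2_norm g = sqrt (LINT x|lborel. (cmod (g x))\<^sup>2)"

type_synonym operator = "((real \<Rightarrow> complex) \<times> (real \<Rightarrow> complex)) set"

definition op_closure :: "operator \<Rightarrow> operator" where
  "op_closure T = {(g, h). g \<in> L2 \<and> h \<in> L2 \<and>
     (\<exists>\<phi> \<psi>. (\<forall>n::nat. (\<phi> n, \<psi> n) \<in> T) \<and>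
        (\<lambda>n. L2_norm (\<lambda>x. \<phi> n x - g x)) \<longlonglongrightarrow> 0 \<and>
        (\<lambda>n. L2_norm (\<lambda>x. \<psi> n x - h x)) \<longlonglongrightarrow> 0)}"

definition is_eigenvalue :: "operator \<Rightarrow> complex \<Rightarrow> bool" where
  "is_eigenvalue T z \<longleftrightarrow>
     (\<exists>g\<in>L2. \<not> (AE x in lborel. g x = 0) \<and> (g, \<lambda>x. z * g x) \<in> T)"


text \<open>Here \<open>D = \<i> d/dx\<close>.\<close>

definition QD :: "real poly \<Rightarrow> (real \<Rightarrow> complex) \<Rightarrow> real \<Rightarrow> complex" where
  "QD Q f x = (\<Sum>k\<le>degree Q. of_real (coeff Q k) * (\<i> ^ k * nderiv k f x))"

definition A0 :: "(real \<Rightarrow> real) \<Rightarrow> real poly \<Rightarrow> operator" where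
  "A0 v Q = {(g, \<lambda>x. of_real (v x) * QD Q (\<lambda>y. of_real (v y) * g y) x) |g.
               g \<in> Ck_compact (degree Q)}"


text \<open>Distributions are represented as functionals on all functions. A distribution of order at
  most \<open>k\<close> also acts on \<open>C\<^sup>k\<close> functions with compact support, and this is what gives a meaning to
  the product \<open>v Q(D)(v g)\<close> for a \<open>v\<close> that is only of class \<open>C\<^sup>k\<close>, \<open>k = degree Q\<close>: the functional
  \<open>Q(D)(v g)\<close> is evaluated on \<open>v \<phi>\<close> for test functions \<open>\<phi>\<close>. The pairing is bilinear, so that the
  transpose of \<open>D\<close> is \<open>-D\<close>.\<close>

type_synonym distribution = "(real \<Rightarrow> complex) \<Rightarrow> complex"

definition distr_of :: "(real \<Rightarrow> complex) \<Rightarrow> distribution" where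
  "distr_of u \<phi> = (LINT x|lborel. u x * \<phi> x)"

definition distr_mult :: "(real \<Rightarrow> real) \<Rightarrow> distribution \<Rightarrow> distribution" where
  "distr_mult v T \<phi> = T (\<lambda>x. of_real (v x) * \<phi> x)"

definition distr_D :: "distribution \<Rightarrow> distribution" where
  "distr_D T \<phi> = T (\<lambda>x. - \<i> * nderiv 1 \<phi> x)"

definition distr_QD :: "real poly \<Rightarrow> distribution \<Rightarrow> distribution" where
  "distr_QD Q T \<phi> = (\<Sum>k\<le>degree Q. of_real (coeff Q k) * (distr_D ^^ k) T \<phi>)"

definition A_distr :: "(real \<Rightarrow> real) \<Rightarrow> real poly \<Rightarrow> operator" where
  "A_distr v Q = {(g, h). g \<in> L2 \<and> h \<in> L2 \<and>
     (\<forall>\<phi>\<in>test_fun.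
        distr_mult v (distr_QD Q (distr_of (\<lambda>x. of_real (v x) * g x))) \<phi> = distr_of h \<phi>)}"

end

theory Submission
  imports Defs "HOL-Computational_Algebra.Fundamental_Theorem_Algebra"
begin

text \<open>If \<open>g\<close> is in the kernel of \<open>A\<close>, then \<open>v Q(D)(v g) = 0\<close>, and since \<open>v\<close> has no zeros the function
  \<open>u = v g\<close> satisfies the constant coefficient equation \<open>Q(D) u = 0\<close> in the weak sense. As \<open>v\<close> is
  bounded, \<open>u\<close> is in \<open>L\<^sup>2\<close>. But the solutions of the equation are exponential polynomials, and none of
  them except zero is square integrable; so \<open>u = 0\<close> and \<open>g = 0\<close> almost everywhere.

  The last step is \<open>L2_weak_solution_eq_0\<close>. It works on the side of the test functions and so avoids
  both the regularity of weak solutions and the Fourier transform: a linear factor \<open>d/dx - c\<close> can be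
  removed from the operator, because the functional that remains would have to behave under
  translations like an exponential, while the pairing of an \<open>L\<^sup>2\<close> function with the translates of a
  fixed test function tends to zero at both ends of the line.

  The weak equation, tested with all functions of class \<open>C\<^sup>K\<close> with compact support, holds for both
  descriptions of \<open>A\<close>. For the closure of \<open>A0 v Q\<close> it follows by integration by parts and passage to the
  limit (\<open>closure_kernel_weak_solution\<close>). For the distributional operator it is given for test
  functions of the form \<open>v \<phi>\<close> with \<open>\<phi>\<close> smooth, and extends since smooth functions approximate those
  of class \<open>C\<^sup>K\<close> together with all derivatives up to order \<open>K\<close> (\<open>test_fun_dense_Ck_compact\<close>,
  \<open>distr_kernel_weak_solution\<close>).\<close>

section \<open>Functions of class $C^k$\<close>

lemma nderiv_0 [simp]: "nderiv 0 f = f"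
  by (simp add: nderiv_def)

lemma nderiv_Suc: "nderiv (Suc k) f = nderiv k (\<lambda>x. vector_derivative f (at x))"
  by (simp only: nderiv_def funpow_Suc_right o_apply)

lemma nderiv_Suc': "nderiv (Suc k) f x = vector_derivative (nderiv k f) (at x)"
  by (simp add: nderiv_def)

lemma nderiv_Suc_eq:
  assumes "\<And>x. (f has_vector_derivative f' x) (at x)"
  shows "nderiv (Suc k) f = nderiv k f'"
proof -
  have "(\<lambda>x. vector_derivative f (at x)) = f'"
    using assms by (auto intro: vector_derivative_at)
  then show ?thesis by (simp add: nderiv_Suc)
qed

lemma Ck_0: "f \<in> Ck 0 \<longleftrightarrow> continuous_on UNIV f"
  by (simp add: Ck_def)

text \<open>Membership in \<open>Ck k\<close> becomes recursive in \<open>k\<close>, with the derivative as a witness. All closure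
  properties below are then inductions on \<open>k\<close> that only need the differentiation rule for one
  derivative, and never a Leibniz or Faa di Bruno formula.\<close>

lemma Ck_Suc_iff:
  "f \<in> Ck (Suc k) \<longleftrightarrow> (\<exists>f'. (\<forall>x. (f has_vector_derivative f' x) (at x)) \<and> f' \<in> Ck k)"
proof
  let ?d = "\<lambda>x. vector_derivative f (at x)"
  assume f: "f \<in> Ck (Suc k)"
  then have "\<forall>x. nderiv 0 f differentiable (at x)"
    unfolding Ck_def by blast
  then have 1: "\<forall>x. (f has_vector_derivative ?d x) (at x)"
    by (simp add: vector_derivative_works)
  have "nderiv j ?d differentiable (at x)" if "j < k" for j x
  proof -
    have "nderiv (Suc j) f differentiable (at x)"
      using f that unfolding Ck_def by blast
    then show ?thesis by (simp add: nderiv_Suc)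
  qed
  moreover have "continuous_on UNIV (nderiv k ?d)"
    using f by (simp add: Ck_def nderiv_Suc)
  ultimately have "?d \<in> Ck k" by (simp add: Ck_def)
  with 1 show "\<exists>f'. (\<forall>x. (f has_vector_derivative f' x) (at x)) \<and> f' \<in> Ck k"
    by (intro exI[of _ ?d]) simp
next
  assume "\<exists>f'. (\<forall>x. (f has_vector_derivative f' x) (at x)) \<and> f' \<in> Ck k"
  then obtain f' where 1: "\<And>x. (f has_vector_derivative f' x) (at x)" and 2: "f' \<in> Ck k"
    by blast
  have "nderiv j f differentiable (at x)" if "j < Suc k" for j x
  proof (cases j)
    case 0
    then show ?thesis using 1 by (auto simp: differentiable_def has_vector_derivative_def)
  next
    case (Suc i)
    then show ?thesis using 2 that by (simp add: nderiv_Suc_eq[OF 1] Ck_def)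
  qed
  moreover have "continuous_on UNIV (nderiv (Suc k) f)"
    using 2 by (simp add: nderiv_Suc_eq[OF 1] Ck_def)
  ultimately show "f \<in> Ck (Suc k)" by (simp add: Ck_def)
qed

lemma Ck_SucI:
  "(\<And>x. (f has_vector_derivative f' x) (at x)) \<Longrightarrow> f' \<in> Ck k \<Longrightarrow> f \<in> Ck (Suc k)"
  using Ck_Suc_iff by blast

lemma Ck_SucE:
  assumes "f \<in> Ck (Suc k)"
  obtains f' where "\<And>x. (f has_vector_derivative f' x) (at x)" "f' \<in> Ck k"
    "\<And>j. nderiv (Suc j) f = nderiv j f'"
proof -
  obtain f' where f': "\<And>x. (f has_vector_derivative f' x) (at x)" "f' \<in> Ck k"
    using assms unfolding Ck_Suc_iff by blast
  show ?thesis by (rule that[OF f' nderiv_Suc_eq[OF f'(1)]])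
qed

lemma Ck_Suc_imp_Ck: "f \<in> Ck (Suc k) \<Longrightarrow> f \<in> Ck k"
proof (induction k arbitrary: f)
  case 0
  then show ?case
    by (auto simp: Ck_0 intro!: continuous_at_imp_continuous_on has_vector_derivative_continuous
        elim!: Ck_SucE)
next
  case (Suc k)
  from Suc.prems show ?case by (rule Ck_SucE) (auto intro: Ck_SucI Suc.IH)
qed

lemma Ck_mono: "f \<in> Ck k \<Longrightarrow> j \<le> k \<Longrightarrow> f \<in> Ck j"
  by (induction k) (auto simp: le_Suc_eq dest: Ck_Suc_imp_Ck)

lemma Ck_continuous: "f \<in> Ck k \<Longrightarrow> continuous_on UNIV f"
  using Ck_mono[of f k 0] by (simp add: Ck_0)

lemma nderiv_in_Ck: "f \<in> Ck (j + k) \<Longrightarrow> nderiv j f \<in> Ck k"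
proof (induction j arbitrary: f)
  case (Suc j)
  from Suc.prems have "f \<in> Ck (Suc (j + k))" by simp
  then show ?case by (rule Ck_SucE) (simp add: Suc.IH)
qed simp

lemma nderiv_continuous: "f \<in> Ck k \<Longrightarrow> j \<le> k \<Longrightarrow> continuous_on UNIV (nderiv j f)"
  using nderiv_in_Ck[of f j "k - j"] Ck_continuous by auto

lemma nderiv_has_vector_derivative:
  assumes "f \<in> Ck k" "j < k"
  shows "(nderiv j f has_vector_derivative nderiv (Suc j) f x) (at x)"
  using assms by (simp add: Ck_def nderiv_Suc' vector_derivative_works[symmetric])

lemma Ck_add: "f \<in> Ck k \<Longrightarrow> g \<in> Ck k \<Longrightarrow> (\<lambda>x. f x + g x) \<in> Ck k"
proof (induction k arbitrary: f g)
  case 0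
  then show ?case by (auto simp: Ck_0 intro: continuous_intros)
next
  case (Suc k)
  obtain f' g' where "\<And>x. (f has_vector_derivative f' x) (at x)" "f' \<in> Ck k"
    "\<And>x. (g has_vector_derivative g' x) (at x)" "g' \<in> Ck k"
    using Suc.prems by (auto elim!: Ck_SucE)
  then show ?case
    by (intro Ck_SucI[of _ "\<lambda>x. f' x + g' x"] Suc.IH) (auto intro: derivative_intros)
qed

lemma Ck_mult:
  fixes f g :: "real \<Rightarrow> 'a::real_normed_algebra"
  shows "f \<in> Ck k \<Longrightarrow> g \<in> Ck k \<Longrightarrow> (\<lambda>x. f x * g x) \<in> Ck k"
proof (induction k arbitrary: f g)
  case 0
  then show ?case by (auto simp: Ck_0 intro: continuous_intros)
next
  case (Suc k)
  obtain f' g' where "\<And>x. (f has_vector_derivative f' x) (at x)" "f' \<in> Ck k"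
    "\<And>x. (g has_vector_derivative g' x) (at x)" "g' \<in> Ck k"
    using Suc.prems by (auto elim!: Ck_SucE)
  then show ?case
    using Suc.prems[THEN Ck_Suc_imp_Ck]
    by (intro Ck_SucI[of _ "\<lambda>x. f x * g' x + f' x * g x"] Ck_add Suc.IH has_vector_derivative_mult)
qed

lemma Ck_const: "(\<lambda>x. c) \<in> Ck k"
proof (induction k arbitrary: c)
  case 0
  then show ?case by (simp add: Ck_0)
next
  case (Suc k)
  then show ?case by (intro Ck_SucI[of _ "\<lambda>x. 0"]) (auto intro: derivative_intros)
qed

lemma Ck_cmult:
  fixes f :: "real \<Rightarrow> 'a::real_normed_algebra"
  shows "f \<in> Ck k \<Longrightarrow> (\<lambda>x. c * f x) \<in> Ck k"
  by (intro Ck_mult Ck_const)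

lemma Ck_diff:
  fixes f g :: "real \<Rightarrow> 'a::real_normed_algebra_1"
  shows "f \<in> Ck k \<Longrightarrow> g \<in> Ck k \<Longrightarrow> (\<lambda>x. f x - g x) \<in> Ck k"
  using Ck_add[OF _ Ck_cmult[of g k "-1"], of f] by simp

lemma Ck_inverse:
  fixes f :: "real \<Rightarrow> 'a::real_normed_field"
  shows "f \<in> Ck k \<Longrightarrow> (\<And>x. f x \<noteq> 0) \<Longrightarrow> (\<lambda>x. inverse (f x)) \<in> Ck k"
proof (induction k)
  case 0
  then show ?case by (auto simp: Ck_0 intro: continuous_intros)
next
  case (Suc k)
  obtain f' where f': "\<And>x. (f has_vector_derivative f' x) (at x)" "f' \<in> Ck k"
    using Suc.prems by (auto elim!: Ck_SucE)
  have "((\<lambda>x. inverse (f x)) has_vector_derivative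
      -1 * (f' x * (inverse (f x) * inverse (f x)))) (at x)" for x
    using field_vector_diff_chain_at[OF f'(1) DERIV_inverse[OF Suc.prems(2)], of x]
    by (simp add: o_def power2_eq_square numeral_2_eq_2)
  then show ?case
    using Suc.IH Suc.prems f'(2) Ck_Suc_imp_Ck
    by (intro Ck_SucI[of _ "\<lambda>x. -1 * (f' x * (inverse (f x) * inverse (f x)))"] Ck_cmult Ck_mult)
       auto
qed

lemma Ck_affine:
  fixes f :: "real \<Rightarrow> 'a::real_normed_algebra_1"
  shows "f \<in> Ck k \<Longrightarrow> (\<lambda>x. f (a * x + b)) \<in> Ck k"
proof (induction k arbitrary: f)
  case 0
  then show ?case
    by (auto simp: Ck_0 intro!: continuous_on_compose2[of UNIV f] continuous_intros)
next
  case (Suc k)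
  obtain f' where f': "\<And>x. (f has_vector_derivative f' x) (at x)" "f' \<in> Ck k"
    using Suc.prems by (auto elim!: Ck_SucE)
  have "((\<lambda>x. f (a * x + b)) has_vector_derivative a *\<^sub>R f' (a * x + b)) (at x)" for x
  proof -
    have "((\<lambda>x. a * x + b) has_vector_derivative a) (at x)"
      by (auto intro!: derivative_eq_intros)
    from vector_diff_chain_at[OF this f'(1)] show ?thesis by (simp add: o_def)
  qed
  moreover have "(\<lambda>x. a *\<^sub>R f' (a * x + b)) \<in> Ck k"
    unfolding scaleR_conv_of_real by (rule Ck_cmult[OF Suc.IH[OF f'(2)]])
  ultimately show ?case by (rule Ck_SucI)
qed

lemma Ck_of_real:
  "f \<in> Ck k \<Longrightarrow> (\<lambda>x. of_real (f x) :: 'a::real_normed_algebra_1) \<in> Ck k"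
proof (induction k arbitrary: f)
  case 0
  then show ?case by (auto simp: Ck_0 intro: continuous_intros)
next
  case (Suc k)
  obtain f' where "\<And>x. (f has_vector_derivative f' x) (at x)" "f' \<in> Ck k"
    using Suc.prems by (auto elim!: Ck_SucE)
  then show ?case
    using Suc.IH
    by (intro Ck_SucI[of _ "\<lambda>x. of_real (f' x)"])
       (auto intro: has_vector_derivative_of_real simp: has_real_derivative_iff_has_vector_derivative)
qed

lemma nderiv_add:
  "f \<in> Ck k \<Longrightarrow> g \<in> Ck k \<Longrightarrow> j \<le> k \<Longrightarrow> nderiv j (\<lambda>x. f x + g x) = (\<lambda>x. nderiv j f x + nderiv j g x)"
proof (induction j arbitrary: k f g)
  case (Suc j)
  then obtain k' where [simp]: "k = Suc k'" by (cases k) auto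
  from Suc.prems(1) obtain f' where f': "\<And>x. (f has_vector_derivative f' x) (at x)" "f' \<in> Ck k'"
    "\<And>j. nderiv (Suc j) f = nderiv j f'" unfolding \<open>k = Suc k'\<close> by (rule Ck_SucE) blast
  from Suc.prems(2) obtain g' where g': "\<And>x. (g has_vector_derivative g' x) (at x)" "g' \<in> Ck k'"
    "\<And>j. nderiv (Suc j) g = nderiv j g'" unfolding \<open>k = Suc k'\<close> by (rule Ck_SucE) blast
  have "nderiv (Suc j) (\<lambda>x. f x + g x) = nderiv j (\<lambda>x. f' x + g' x)"
    using f' g' by (intro nderiv_Suc_eq derivative_intros)
  also have "\<dots> = (\<lambda>x. nderiv j f' x + nderiv j g' x)"
    using Suc.prems f' g' by (intro Suc.IH[of _ k']) auto
  finally show ?case by (simp add: f' g')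
qed simp

lemma nderiv_cmult:
  fixes f :: "real \<Rightarrow> 'a::real_normed_algebra"
  shows "f \<in> Ck k \<Longrightarrow> j \<le> k \<Longrightarrow> nderiv j (\<lambda>x. c * f x) = (\<lambda>x. c * nderiv j f x)"
proof (induction j arbitrary: k f)
  case (Suc j)
  then obtain k' where [simp]: "k = Suc k'" by (cases k) auto
  from Suc.prems(1) obtain f' where f': "\<And>x. (f has_vector_derivative f' x) (at x)" "f' \<in> Ck k'"
    "\<And>j. nderiv (Suc j) f = nderiv j f'" unfolding \<open>k = Suc k'\<close> by (rule Ck_SucE) blast
  have "nderiv (Suc j) (\<lambda>x. c * f x) = nderiv j (\<lambda>x. c * f' x)"
    using f' by (intro nderiv_Suc_eq derivative_intros)
  also have "\<dots> = (\<lambda>x. c * nderiv j f' x)"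
    using Suc.prems f' by (intro Suc.IH[of _ k']) auto
  finally show ?case by (simp add: f')
qed simp

lemma nderiv_shift:
  "f \<in> Ck k \<Longrightarrow> j \<le> k \<Longrightarrow> nderiv j (\<lambda>x. f (x - s)) = (\<lambda>x. nderiv j f (x - s))"
proof (induction j arbitrary: k f)
  case (Suc j)
  then obtain k' where [simp]: "k = Suc k'" by (cases k) auto
  from Suc.prems(1) obtain f' where f': "\<And>x. (f has_vector_derivative f' x) (at x)" "f' \<in> Ck k'"
    "\<And>j. nderiv (Suc j) f = nderiv j f'" unfolding \<open>k = Suc k'\<close> by (rule Ck_SucE) blast
  have "((\<lambda>x. f (x - s)) has_vector_derivative f' (x - s)) (at x)" for x
  proof -
    have "((\<lambda>x. x - s) has_vector_derivative 1) (at x)"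
      by (auto intro!: derivative_eq_intros)
    from vector_diff_chain_at[OF this f'(1)] show ?thesis by (simp add: o_def)
  qed
  then have "nderiv (Suc j) (\<lambda>x. f (x - s)) = nderiv j (\<lambda>x. f' (x - s))"
    by (rule nderiv_Suc_eq)
  also have "\<dots> = (\<lambda>x. nderiv j f' (x - s))"
    using Suc.prems f' by (intro Suc.IH[of _ k']) auto
  finally show ?case by (simp add: f')
qed simp

lemma nderiv_eq_0_on_open:
  assumes "open U" "\<And>x. x \<in> U \<Longrightarrow> f x = 0" "x \<in> U"
  shows "nderiv j f x = 0"
  using assms(3)
proof (induction j arbitrary: x)
  case 0
  then show ?case by (simp add: assms(2))
next
  case (Suc j)
  have "(nderiv j f has_vector_derivative 0) (at x)"
    by (rule has_vector_derivative_transform_within_open[OF _ assms(1) Suc.prems, of "\<lambda>x. 0"])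
       (simp_all add: Suc.IH)
  then show ?case by (simp add: nderiv_Suc' vector_derivative_at)
qed

lemma Ck_compact_iff: "f \<in> Ck_compact k \<longleftrightarrow> f \<in> Ck k \<and> (\<exists>R. \<forall>x. R < \<bar>x\<bar> \<longrightarrow> f x = 0)"
proof -
  have "compact (closure {x. f x \<noteq> 0}) \<longleftrightarrow> (\<exists>R. \<forall>x\<in>{x. f x \<noteq> 0}. norm x \<le> R)"
    unfolding compact_closure bounded_iff ..
  also have "\<dots> \<longleftrightarrow> (\<exists>R. \<forall>x. R < \<bar>x\<bar> \<longrightarrow> f x = 0)"
    by (intro ex_cong1) (auto simp: not_less[symmetric])
  finally show ?thesis by (simp add: Ck_compact_def)
qed

section \<open>Approximation of $C^k$ functions by test functions\<close>

text \<open>The powers of \<open>1/x\<close> are carried along because the family of all \<open>flat_exp n\<close> is closed under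
  differentiation up to linear combinations, which makes smoothness of \<open>exp (-1/x)\<close>, continued by
  zero, an induction.\<close>

definition flat_exp :: "nat \<Rightarrow> real \<Rightarrow> real" where
  "flat_exp n x = (if 0 < x then inverse x ^ n * exp (- inverse x) else 0)"

lemma flat_exp_tendsto_0: "(flat_exp n \<longlongrightarrow> 0) (at 0)"
proof -
  have "((\<lambda>x. inverse x ^ n / exp (inverse x)) \<longlongrightarrow> (0::real)) (at_right 0)"
    using filterlim_compose[OF tendsto_power_div_exp_0 filterlim_inverse_at_top_right] .
  moreover have "\<forall>\<^sub>F x in at_right 0. flat_exp n x = inverse x ^ n / exp (inverse x)"
    using eventually_at_right_less[of "0::real"]
    by eventually_elim (simp add: flat_exp_def exp_minus divide_inverse)
  ultimately have "(flat_exp n \<longlongrightarrow> 0) (at_right 0)"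
    by (simp add: tendsto_cong)
  moreover have "(flat_exp n \<longlongrightarrow> 0) (at_left 0)"
  proof (rule tendsto_eventually)
    have "\<forall>\<^sub>F x in at_left 0. x < (0::real)"
      by (auto simp: eventually_at intro: exI[of _ 1])
    then show "\<forall>\<^sub>F x in at_left 0. flat_exp n x = 0"
      by eventually_elim (simp add: flat_exp_def)
  qed
  ultimately show ?thesis by (simp add: filterlim_split_at)
qed

lemma flat_exp_derivative:
  "(flat_exp n has_vector_derivative (- real n * flat_exp (Suc n) x + flat_exp (n + 2) x)) (at x)"
proof -
  consider "x > 0" | "x = 0" | "x < 0" by linarith
  then have "(flat_exp n has_real_derivative (- real n * flat_exp (Suc n) x + flat_exp (n + 2) x)) (at x)"
  proof cases
    case 1
    have "((\<lambda>x. inverse x ^ n * exp (- inverse x)) has_real_derivative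
        (- real n * flat_exp (Suc n) x + flat_exp (n + 2) x)) (at x)"
      using 1
      by (cases n, auto intro!: derivative_eq_intros simp: flat_exp_def field_simps power2_eq_square)
         (metis One_nat_def power_eq_if)
    then show ?thesis
      by (rule has_field_derivative_transform_within_open[of _ _ _ "{0<..}"])
         (use 1 in \<open>auto simp: flat_exp_def\<close>)
  next
    case 2
    have "\<forall>\<^sub>F y in at 0. flat_exp (Suc n) y = (flat_exp n y - flat_exp n 0) / (y - 0)"
      by (auto simp: eventually_at_filter flat_exp_def field_simps)
    then have "((\<lambda>y. (flat_exp n y - flat_exp n 0) / (y - 0)) \<longlongrightarrow> 0) (at 0)"
      using flat_exp_tendsto_0[of "Suc n"] by (simp add: tendsto_cong)
    then show ?thesis using 2 by (simp add: has_field_derivative_iff flat_exp_def)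
  next
    case 3
    have "((\<lambda>x. 0) has_real_derivative 0) (at x)" by simp
    then have "(flat_exp n has_real_derivative 0) (at x)"
      by (rule has_field_derivative_transform_within_open[of _ _ _ "{..<0}"])
         (use 3 in \<open>auto simp: flat_exp_def\<close>)
    then show ?thesis using 3 by (simp add: flat_exp_def)
  qed
  then show ?thesis by (simp add: has_real_derivative_iff_has_vector_derivative)
qed

lemma flat_exp_smooth: "flat_exp n \<in> Ck k"
proof (induction k arbitrary: n)
  case 0
  have "isCont (flat_exp n) x" for x
    using has_vector_derivative_continuous[OF flat_exp_derivative] .
  then show ?case by (simp add: Ck_0 continuous_at_imp_continuous_on)
next
  case (Suc k)
  show ?case by (rule Ck_SucI[OF flat_exp_derivative]) (intro Ck_add Ck_cmult Suc.IH)
qed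

text \<open>The denominator is positive because \<open>x\<close> and \<open>1 - x\<close> are not both \<open>\<le> 0\<close>. Hence this
  is a smooth function that is \<open>0\<close> for \<open>x \<le> 0\<close> and \<open>1\<close> for \<open>x \<ge> 1\<close>.\<close>

definition smooth_step :: "real \<Rightarrow> real" where
  "smooth_step x = flat_exp 0 x * inverse (flat_exp 0 x + flat_exp 0 (1 - x))"

lemma smooth_step_smooth: "smooth_step \<in> Ck k"
proof -
  have "(\<lambda>x. flat_exp 0 (- 1 * x + 1)) \<in> Ck k"
    by (intro Ck_affine flat_exp_smooth)
  then have "(\<lambda>x. flat_exp 0 (1 - x)) \<in> Ck k" by simp
  moreover have "flat_exp 0 x + flat_exp 0 (1 - x) \<noteq> 0" for x
    using add_pos_pos[of "exp (- inverse x)" "exp (- inverse (1 - x))"]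
    by (auto simp: flat_exp_def simp del: add_pos_pos)
  ultimately show ?thesis
    unfolding smooth_step_def[abs_def] by (intro Ck_mult Ck_inverse Ck_add flat_exp_smooth)
qed

lemma smooth_cutoff_exists:
  obtains \<theta> where "\<theta> \<in> test_fun" "\<And>x. \<bar>x\<bar> \<le> R \<Longrightarrow> \<theta> x = 1" "\<And>x. R + 1 < \<bar>x\<bar> \<Longrightarrow> \<theta> x = 0"
proof
  \<comment> \<open>A rising step at \<open>- R - 1\<close> times a falling step at \<open>R + 1\<close>.\<close>
  let ?\<theta> = "\<lambda>x. of_real (smooth_step (1 * x + (R + 1)) * smooth_step (- 1 * x + (R + 1))) :: complex"
  show 1: "?\<theta> x = 1" if "\<bar>x\<bar> \<le> R" for x
    using that by (auto simp: smooth_step_def flat_exp_def abs_le_iff)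
  show 0: "?\<theta> x = 0" if "R + 1 < \<bar>x\<bar>" for x
    using that by (auto simp: smooth_step_def flat_exp_def)
  have "?\<theta> \<in> Ck k" for k
    by (intro Ck_of_real Ck_mult Ck_affine smooth_step_smooth)
  then show "?\<theta> \<in> test_fun"
    using 0 unfolding test_fun_def by (auto simp: Ck_compact_iff)
qed

lemma antiderivative_exists:
  fixes f :: "real \<Rightarrow> 'a::euclidean_space"
  assumes "continuous_on UNIV f"
  obtains F where "\<And>x. (F has_vector_derivative f x) (at x)"
proof -
  have "\<exists>F. \<forall>x. -\<infinity> < ereal x \<longrightarrow> ereal x < \<infinity> \<longrightarrow> (F has_vector_derivative f x) (at x)"
    using assms by (intro einterval_antiderivative) (auto simp: continuous_on_eq_continuous_at)
  then show ?thesis using that by auto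
qed

lemma polynomial_function_smooth:
  fixes p :: "real \<Rightarrow> 'a::euclidean_space"
  shows "polynomial_function p \<Longrightarrow> p \<in> Ck k"
proof (induction k arbitrary: p)
  case 0
  then show ?case by (simp add: Ck_0 continuous_on_polymonial_function)
next
  case (Suc k)
  obtain p' where "polynomial_function p'" "\<And>x. (p has_vector_derivative p' x) (at x)"
    using has_vector_derivative_polynomial_function[OF Suc.prems] by blast
  with Suc.IH show ?case by (auto intro: Ck_SucI)
qed

text \<open>Only the top derivative is approximated by a polynomial, by the theorem of Weierstrass; integrating
  back \<open>k\<close> times, with the initial values of \<open>f\<close> at \<open>0\<close>, keeps all lower derivatives close on a
  bounded interval and preserves smoothness.\<close>

lemma Ck_approx_smooth:
  fixes f :: "real \<Rightarrow> 'a::euclidean_space"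
  assumes "f \<in> Ck k" "e > 0" "R \<ge> 0"
  shows "\<exists>g. (\<forall>m. g \<in> Ck m) \<and> (\<forall>j\<le>k. \<forall>x\<in>{-R..R}. norm (nderiv j g x - nderiv j f x) < e)"
  using assms(1,2)
proof (induction k arbitrary: f e)
  case 0
  then have "continuous_on {-R..R} f" by (auto simp: Ck_0 intro: continuous_on_subset)
  then obtain g where "polynomial_function g" "\<And>x. x \<in> {-R..R} \<Longrightarrow> norm (f x - g x) < e"
    using Stone_Weierstrass_polynomial_function[of "{-R..R}" f e] 0 by auto
  then show ?case
    by (intro exI[of _ g]) (auto simp: polynomial_function_smooth norm_minus_commute)
next
  case (Suc k)
  from Suc.prems(1) obtain f' where f': "\<And>x. (f has_vector_derivative f' x) (at x)" "f' \<in> Ck k"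
    "\<And>j. nderiv (Suc j) f = nderiv j f'" by (rule Ck_SucE) blast
  \<comment> \<open>Integration from \<open>0\<close> multiplies the error by at most \<open>R\<close>, and the
    derivatives themselves must be \<open>e\<close>-close as well.\<close>
  define d where "d = e / (R + 1)"
  have d: "d > 0" "d \<le> e" "d * R < e"
    using Suc.prems(2) assms(3) by (auto simp: d_def field_simps)
  obtain g' where g': "\<And>m. g' \<in> Ck m"
    "\<And>j x. j \<le> k \<Longrightarrow> x \<in> {-R..R} \<Longrightarrow> norm (nderiv j g' x - nderiv j f' x) < d"
    using Suc.IH[OF f'(2) d(1)] by blast
  obtain G where G: "\<And>x. (G has_vector_derivative g' x) (at x)"
    using antiderivative_exists[OF Ck_continuous[OF g'(1)]] by blast
  define g where "g x = G x + (f 0 - G 0)" for x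
  have g: "(g has_vector_derivative g' x) (at x)" for x
    unfolding g_def[abs_def] has_vector_derivative_add_const by (rule G)
  have "g \<in> Ck (Suc m)" for m by (rule Ck_SucI[OF g g'(1)])
  then have smooth: "\<And>m. g \<in> Ck m" using Ck_Suc_imp_Ck by blast
  have "norm (nderiv j g x - nderiv j f x) < e" if j: "j \<le> Suc k" and x: "x \<in> {-R..R}" for j x
  proof (cases j)
    case 0
    have "norm ((g x - f x) - (g 0 - f 0)) \<le> d * norm (x - 0)"
    proof (rule differentiable_bound)
      show "((\<lambda>x. g x - f x) has_derivative (\<lambda>h. h *\<^sub>R (g' y - f' y))) (at y within {-R..R})" for y
        unfolding has_vector_derivative_def[symmetric]
        by (rule has_vector_derivative_at_within[OF has_vector_derivative_diff[OF g f'(1)]])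
      show "onorm (\<lambda>h. h *\<^sub>R (g' y - f' y)) \<le> d" if "y \<in> {-R..R}" for y
      proof (rule onorm_le)
        fix h :: real
        have "norm (g' y - f' y) \<le> d" using g'(2)[of 0 y] that by simp
        then show "norm (h *\<^sub>R (g' y - f' y)) \<le> d * norm h"
          by (simp add: mult.commute[of d] mult_left_mono)
      qed
    qed (use x assms(3) in auto)
    also have "\<dots> \<le> d * R" using x d by (intro mult_left_mono) auto
    finally show ?thesis using d 0 by (simp add: g_def)
  next
    case (Suc i)
    then show ?thesis
      using g'(2)[of i x] j x d(2) by (simp add: f' nderiv_Suc_eq[OF g])
  qed
  with smooth show ?case by blast
qed

lemma Ck_approx_smooth_seq:
  fixes f :: "real \<Rightarrow> 'a::euclidean_space"
  assumes "f \<in> Ck k"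
  obtains g where "\<And>n m. g n \<in> Ck m"
    "\<And>j. j \<le> k \<Longrightarrow> uniform_limit {-R..R} (\<lambda>n. nderiv j (g n)) (nderiv j f) sequentially"
proof -
  have "\<forall>n. \<exists>g. (\<forall>m. g \<in> Ck m) \<and>
      (\<forall>j\<le>k. \<forall>x\<in>{-\<bar>R\<bar>..\<bar>R\<bar>}. norm (nderiv j g x - nderiv j f x) < inverse (real (Suc n)))"
    using Ck_approx_smooth[OF assms] by simp
  then obtain g where g: "\<And>n m. g n \<in> Ck m"
    "\<And>n j x. j \<le> k \<Longrightarrow> x \<in> {-\<bar>R\<bar>..\<bar>R\<bar>} \<Longrightarrow>
      norm (nderiv j (g n) x - nderiv j f x) < inverse (real (Suc n))"
    by metis
  have "uniform_limit {-R..R} (\<lambda>n. nderiv j (g n)) (nderiv j f) sequentially" if "j \<le> k" for j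
  proof (rule uniform_limitI)
    fix e :: real assume "0 < e"
    have "(\<lambda>n. inverse (real (Suc n))) \<longlonglongrightarrow> 0" by (rule LIMSEQ_inverse_real_of_nat)
    then have "\<forall>\<^sub>F n in sequentially. inverse (real (Suc n)) < e"
      using \<open>0 < e\<close> by (rule order_tendstoD)
    then show "\<forall>\<^sub>F n in sequentially. \<forall>x\<in>{-R..R}. dist (nderiv j (g n) x) (nderiv j f x) < e"
    proof eventually_elim
      case (elim n)
      show ?case
      proof
        fix x assume "x \<in> {-R..R}"
        then have "x \<in> {-\<bar>R\<bar>..\<bar>R\<bar>}" by auto
        from g(2)[OF that this, of n] elim show "dist (nderiv j (g n) x) (nderiv j f x) < e"
          by (simp add: dist_norm)
      qed
    qed
  qed
  with g(1) that show ?thesis by blast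
qed

text \<open>Convergence of all derivatives up to order \<open>k\<close> survives multiplication by a fixed function of class
  \<open>C\<^sup>k\<close>: by the product rule the derivative of \<open>w f\<^sub>n\<close> is a sum of two products of the same kind,
  one order lower.\<close>

lemma uniform_limit_nderiv_mult:
  fixes w F :: "real \<Rightarrow> 'a::real_normed_algebra"
  assumes S: "compact S"
  shows "w \<in> Ck k \<Longrightarrow> F \<in> Ck k \<Longrightarrow> (\<And>n. f n \<in> Ck k) \<Longrightarrow>
    (\<And>j. j \<le> k \<Longrightarrow> uniform_limit S (\<lambda>n. nderiv j (f n)) (nderiv j F) sequentially) \<Longrightarrow> j \<le> k \<Longrightarrow>
    uniform_limit S (\<lambda>n. nderiv j (\<lambda>x. w x * f n x)) (nderiv j (\<lambda>x. w x * F x)) sequentially"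
proof (induction j arbitrary: k w f F)
  case 0
  have bdd: "bounded (h ` S)" if "h \<in> Ck k" for h :: "real \<Rightarrow> 'a"
    using Ck_continuous[OF that] S
    by (meson compact_continuous_image compact_imp_bounded continuous_on_subset subset_UNIV)
  have "uniform_limit S f F sequentially" using 0(4)[of 0] by simp
  then have "uniform_limit S (\<lambda>n x. w x * f n x) (\<lambda>x. w x * F x) sequentially"
    by (rule uniform_lim_mult[OF uniform_limit_const _ bdd[OF 0(1)] bdd[OF 0(2)]])
  then show ?case by simp
next
  case (Suc j)
  then obtain k' where k: "k = Suc k'" by (cases k) auto
  from Suc.prems(1) obtain w' where w': "\<And>x. (w has_vector_derivative w' x) (at x)" "w' \<in> Ck k'"
    unfolding k by (rule Ck_SucE) blast
  from Suc.prems(2) obtain F' where F': "\<And>x. (F has_vector_derivative F' x) (at x)" "F' \<in> Ck k'"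
    "\<And>j. nderiv (Suc j) F = nderiv j F'" unfolding k by (rule Ck_SucE) blast
  have "\<forall>n. \<exists>f'. (\<forall>x. (f n has_vector_derivative f' x) (at x)) \<and> f' \<in> Ck k'"
    using Suc.prems(3) unfolding k Ck_Suc_iff by blast
  then obtain f' where f': "\<And>n x. (f n has_vector_derivative f' n x) (at x)" "\<And>n. f' n \<in> Ck k'"
    by metis
  note low = Suc.prems(1-3)[unfolded k, THEN Ck_Suc_imp_Ck]
  have j: "j \<le> k'" using Suc.prems(5) k by simp
  have split: "nderiv (Suc j) (\<lambda>x. w x * h x) =
      (\<lambda>x. nderiv j (\<lambda>x. w x * h' x) x + nderiv j (\<lambda>x. w' x * h x) x)"
    if "\<And>x. (h has_vector_derivative h' x) (at x)" "h' \<in> Ck k'" "h \<in> Ck k'" for h h'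
  proof -
    have "nderiv (Suc j) (\<lambda>x. w x * h x) = nderiv j (\<lambda>x. w x * h' x + w' x * h x)"
      by (intro nderiv_Suc_eq has_vector_derivative_mult w' that)
    then show ?thesis
      using nderiv_add[OF Ck_mult[OF low(1) that(2)] Ck_mult[OF w'(2) that(3)] j] by simp
  qed
  have "uniform_limit S (\<lambda>n. nderiv i (f' n)) (nderiv i F') sequentially" if "i \<le> k'" for i
    using Suc.prems(4)[of "Suc i"] that by (simp add: k F'(3) nderiv_Suc_eq[OF f'(1)])
  then have 1: "uniform_limit S (\<lambda>n. nderiv j (\<lambda>x. w x * f' n x)) (nderiv j (\<lambda>x. w x * F' x)) sequentially"
    by (rule Suc.IH[OF low(1) F'(2) f'(2) _ j])
  have 2: "uniform_limit S (\<lambda>n. nderiv j (\<lambda>x. w' x * f n x)) (nderiv j (\<lambda>x. w' x * F x)) sequentially"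
    using Suc.IH[OF w'(2) low(2) low(3) _ j] Suc.prems(4) k by simp
  show ?case
    unfolding split[OF F'(1,2) low(2)] split[OF f' low(3)] by (intro uniform_limit_add 1 2)
qed

text \<open>A distribution of the form \<open>u Q(D)(w \<cdot>)\<close> with \<open>w\<close> only of class \<open>C\<^sup>k\<close> is known on smooth test
  functions, but has to be evaluated on functions of class \<open>C\<^sup>k\<close>. The approximants are smooth
  functions close to \<open>\<psi>\<close> on an interval, multiplied by a cutoff that equals \<open>1\<close> on the support
  of \<open>\<psi>\<close>; the cutoff is absorbed into \<open>w\<close>.\<close>

lemma test_fun_dense_Ck_compact:
  assumes "\<psi> \<in> Ck_compact k" "w \<in> Ck k"
  obtains \<phi> R where "\<And>n. \<phi> n \<in> test_fun" "\<And>n x. R < \<bar>x\<bar> \<Longrightarrow> \<phi> n x = 0"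
    "\<And>x. R < \<bar>x\<bar> \<Longrightarrow> \<psi> x = 0"
    "\<And>j. j \<le> k \<Longrightarrow> uniform_limit {-R..R} (\<lambda>n. nderiv j (\<lambda>x. w x * \<phi> n x))
        (nderiv j (\<lambda>x. w x * \<psi> x)) sequentially"
proof -
  obtain r where \<psi>: "\<psi> \<in> Ck k" and r: "\<And>x. r < \<bar>x\<bar> \<Longrightarrow> \<psi> x = 0"
    using assms(1) by (auto simp: Ck_compact_iff)
  obtain \<theta> where \<theta>: "\<theta> \<in> test_fun" "\<And>x. \<bar>x\<bar> \<le> r \<Longrightarrow> \<theta> x = 1" "\<And>x. r + 1 < \<bar>x\<bar> \<Longrightarrow> \<theta> x = 0"
    using smooth_cutoff_exists[of r] by blast
  have \<theta>_Ck: "\<theta> \<in> Ck m" for m using \<theta>(1) by (auto simp: test_fun_def Ck_compact_iff)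
  obtain g where g: "\<And>n m. g n \<in> Ck m"
    "\<And>j. j \<le> k \<Longrightarrow> uniform_limit {-(r+1)..r+1} (\<lambda>n. nderiv j (g n)) (nderiv j \<psi>) sequentially"
    by (rule Ck_approx_smooth_seq[OF \<psi>, of "r + 1"]) blast
  show ?thesis
  proof (rule that[of "\<lambda>n x. \<theta> x * g n x" "r + 1"])
    show "(\<lambda>x. \<theta> x * g n x) \<in> test_fun" for n
      unfolding test_fun_def Ck_compact_iff
      using \<theta>(3) by (auto intro!: Ck_mult \<theta>_Ck g simp: Ck_compact_iff)
    have "(\<lambda>x. w x * \<psi> x) = (\<lambda>x. (w x * \<theta> x) * \<psi> x)"
    proof
      fix x show "w x * \<psi> x = (w x * \<theta> x) * \<psi> x"
        using r[of x] \<theta>(2)[of x] by (cases "\<bar>x\<bar> \<le> r") auto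
    qed
    then show "uniform_limit {-(r+1)..r+1} (\<lambda>n. nderiv j (\<lambda>x. w x * (\<theta> x * g n x)))
        (nderiv j (\<lambda>x. w x * \<psi> x)) sequentially" if "j \<le> k" for j
      using uniform_limit_nderiv_mult[OF compact_Icc Ck_mult[OF assms(2) \<theta>_Ck] \<psi> g(1) g(2) that]
      by (simp add: mult.assoc)
  qed (use \<theta>(3) r in auto)
qed

section \<open>The bilinear pairing on square-integrable functions\<close>

lemma L2_measurable: "f \<in> L2 \<Longrightarrow> f \<in> borel_measurable borel"
  by (simp add: L2_def)

lemma L2_integrable_square: "f \<in> L2 \<Longrightarrow> integrable lborel (\<lambda>x. (cmod (f x))\<^sup>2)"
  by (simp add: L2_def)

lemma L2_bound:
  assumes "g \<in> L2" "f \<in> borel_measurable borel" "\<And>x. cmod (f x) \<le> B * cmod (g x)"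
  shows "f \<in> L2"
proof -
  have "integrable lborel (\<lambda>x. B\<^sup>2 * (cmod (g x))\<^sup>2)"
    using assms(1) by (intro integrable_mult_right L2_integrable_square)
  then have "integrable lborel (\<lambda>x. (cmod (f x))\<^sup>2)"
  proof (rule Bochner_Integration.integrable_bound)
    have "(cmod (f x))\<^sup>2 \<le> B\<^sup>2 * (cmod (g x))\<^sup>2" for x
      using power_mono[OF assms(3) norm_ge_zero, of x 2] by (simp add: power_mult_distrib)
    then show "AE x in lborel. norm ((cmod (f x))\<^sup>2) \<le> norm (B\<^sup>2 * (cmod (g x))\<^sup>2)"
      by simp
  qed (use assms(2) in simp)
  with assms(2) show ?thesis by (simp add: L2_def)
qed

text \<open>With the free weight \<open>d\<close> this elementary inequality replaces the Cauchy--Schwarz inequality: a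
  factor that is small in \<open>L\<^sup>2\<close> is paired with a bounded one, and \<open>d\<close> is chosen afterwards.\<close>

lemma norm_mult_le_weighted_squares:
  fixes a b :: complex
  assumes "0 < d"
  shows "norm (a * b) \<le> (cmod a)\<^sup>2 / d + d * (cmod b)\<^sup>2"
proof -
  have "0 \<le> (cmod a - d * cmod b)\<^sup>2" "0 \<le> d * (cmod a * cmod b)"
    using assms by simp_all
  then have "cmod a * cmod b * d \<le> (cmod a)\<^sup>2 + (d * cmod b)\<^sup>2"
    by (simp add: power2_diff algebra_simps power_mult_distrib)
  then show ?thesis
    using assms by (simp add: norm_mult field_simps power2_eq_square)
qed

lemma L2_mult_integrable:
  assumes "f \<in> L2" "g \<in> L2"
  shows "integrable lborel (\<lambda>x. f x * g x)"
proof (rule Bochner_Integration.integrable_bound)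
  show "integrable lborel (\<lambda>x. (cmod (f x))\<^sup>2 + (cmod (g x))\<^sup>2)"
    using assms by (intro Bochner_Integration.integrable_add L2_integrable_square)
  show "AE x in lborel. norm (f x * g x) \<le> norm ((cmod (f x))\<^sup>2 + (cmod (g x))\<^sup>2)"
    using norm_mult_le_weighted_squares[of 1] by simp
  show "(\<lambda>x. f x * g x) \<in> borel_measurable lborel"
    using L2_measurable[OF assms(1)] L2_measurable[OF assms(2)] by measurable
qed

lemma L2_pairing_bound:
  assumes "f \<in> L2" "g \<in> L2" "0 < d"
  shows "norm (LINT x|lborel. f x * g x) \<le>
    (LINT x|lborel. (cmod (f x))\<^sup>2) / d + d * (LINT x|lborel. (cmod (g x))\<^sup>2)"
proof -
  have "norm (LINT x|lborel. f x * g x) \<le> (LINT x|lborel. (cmod (f x))\<^sup>2 / d + d * (cmod (g x))\<^sup>2)"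
  proof (rule Bochner_Integration.integral_norm_bound_integral)
    show "integrable lborel (\<lambda>x. (cmod (f x))\<^sup>2 / d + d * (cmod (g x))\<^sup>2)"
      using assms by (intro Bochner_Integration.integrable_add integrable_divide integrable_mult_right
          L2_integrable_square)
  qed (use assms L2_mult_integrable norm_mult_le_weighted_squares in auto)
  also have "\<dots> = (LINT x|lborel. (cmod (f x))\<^sup>2) / d + d * (LINT x|lborel. (cmod (g x))\<^sup>2)"
    using assms L2_integrable_square by (subst Bochner_Integration.integral_add) auto
  finally show ?thesis .
qed

lemma L2_pairing_tendsto_0:
  assumes "\<And>n. f n \<in> L2" "\<And>n. g n \<in> L2"
    and f: "(\<lambda>n. LINT x|lborel. (cmod (f n x))\<^sup>2) \<longlonglongrightarrow> 0"
    and g: "\<And>n. (LINT x|lborel. (cmod (g n x))\<^sup>2) \<le> B"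
  shows "(\<lambda>n. LINT x|lborel. f n x * g n x) \<longlonglongrightarrow> 0"
proof (rule LIMSEQ_I)
  fix e :: real assume "0 < e"
  have "0 \<le> (LINT x|lborel. (cmod (g 0 x))\<^sup>2)" by simp
  then have B: "0 \<le> B" using g[of 0] by (rule order_trans)
  define d where "d = e / (2 * (B + 1))"
  have d: "0 < d" "d * B < e / 2" using \<open>0 < e\<close> B by (auto simp: d_def field_simps)
  have "\<forall>\<^sub>F n in sequentially. (LINT x|lborel. (cmod (f n x))\<^sup>2) < d * e / 2"
    by (rule order_tendstoD(2)[OF f]) (use d(1) \<open>0 < e\<close> in simp)
  then obtain n0 where n0: "\<And>n. n \<ge> n0 \<Longrightarrow> (LINT x|lborel. (cmod (f n x))\<^sup>2) < d * e / 2"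
    by (auto simp: eventually_sequentially)
  have "norm (LINT x|lborel. f n x * g n x) < e" if "n \<ge> n0" for n
  proof -
    have "norm (LINT x|lborel. f n x * g n x) \<le>
        (LINT x|lborel. (cmod (f n x))\<^sup>2) / d + d * (LINT x|lborel. (cmod (g n x))\<^sup>2)"
      by (intro L2_pairing_bound assms d)
    also have "\<dots> < e / 2 + e / 2"
    proof (rule add_less_le_mono)
      show "(LINT x|lborel. (cmod (f n x))\<^sup>2) / d < e / 2"
        using n0[OF that] d by (simp add: field_simps)
      show "d * (LINT x|lborel. (cmod (g n x))\<^sup>2) \<le> e / 2"
        using mult_left_mono[OF g[of n], of d] d by linarith
    qed
    finally show ?thesis by simp
  qed
  then show "\<exists>n0. \<forall>n\<ge>n0. norm ((LINT x|lborel. f n x * g n x) - 0) < e" by auto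
qed

lemma continuous_compact_support_L2:
  assumes "continuous_on UNIV f" "\<And>x. R < \<bar>x\<bar> \<Longrightarrow> f x = 0"
  shows "f \<in> L2"
proof -
  have "integrable lborel (\<lambda>x. indicator {-R..R} x *\<^sub>R (cmod (f x))\<^sup>2)"
    by (intro borel_integrable_compact compact_Icc)
       (auto intro!: continuous_intros continuous_on_subset[OF assms(1)])
  moreover have "(\<lambda>x. indicator {-R..R} x *\<^sub>R (cmod (f x))\<^sup>2) = (\<lambda>x. (cmod (f x))\<^sup>2)"
  proof
    fix x show "indicator {-R..R} x *\<^sub>R (cmod (f x))\<^sup>2 = (cmod (f x))\<^sup>2"
      using assms(2)[of x] by (cases "\<bar>x\<bar> \<le> R") (auto simp: indicator_def abs_le_iff)
  qed
  ultimately show ?thesis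
    using assms(1) by (simp add: L2_def borel_measurable_continuous_onI)
qed

lemma L2_diff:
  assumes "f \<in> L2" "g \<in> L2"
  shows "(\<lambda>x. f x - g x) \<in> L2"
proof -
  have "integrable lborel (\<lambda>x. 2 * (cmod (f x))\<^sup>2 + 2 * (cmod (g x))\<^sup>2)"
    using assms by (intro Bochner_Integration.integrable_add integrable_mult_right L2_integrable_square)
  then have "integrable lborel (\<lambda>x. (cmod (f x - g x))\<^sup>2)"
  proof (rule Bochner_Integration.integrable_bound)
    have "(cmod (f x - g x))\<^sup>2 \<le> 2 * (cmod (f x))\<^sup>2 + 2 * (cmod (g x))\<^sup>2" for x
    proof -
      have "(cmod (f x - g x))\<^sup>2 \<le> (cmod (f x) + cmod (g x))\<^sup>2"
        by (intro power_mono norm_triangle_ineq4 norm_ge_zero)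
      also have "\<dots> \<le> 2 * (cmod (f x))\<^sup>2 + 2 * (cmod (g x))\<^sup>2"
        using zero_le_power2[of "cmod (f x) - cmod (g x)"] by (simp add: power2_sum power2_diff)
      finally show ?thesis .
    qed
    then show "AE x in lborel. norm ((cmod (f x - g x))\<^sup>2) \<le> norm (2 * (cmod (f x))\<^sup>2 + 2 * (cmod (g x))\<^sup>2)"
      by simp
  qed (use L2_measurable[OF assms(1)] L2_measurable[OF assms(2)] in measurable)
  then show ?thesis
    using L2_measurable[OF assms(1)] L2_measurable[OF assms(2)] by (simp add: L2_def)
qed

text \<open>Translates of a fixed function of compact support converge weakly to zero when they move off to
  infinity, because they only see the part of \<open>u\<close> outside a growing interval, whose \<open>L\<^sup>2\<close> norm tends
  to zero.\<close>

lemma L2_pairing_translate_tendsto_0: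
  assumes u: "u \<in> L2" and h: "continuous_on UNIV h" "\<And>x. R < \<bar>x\<bar> \<Longrightarrow> h x = 0"
    and s: "filterlim (\<lambda>n. \<bar>s n\<bar>) at_top sequentially"
  shows "(\<lambda>n. LINT x|lborel. u x * h (x - s n)) \<longlonglongrightarrow> 0"
proof -
  define A where "A n = {x. \<bar>s n\<bar> - R \<le> \<bar>x\<bar>}" for n
  define w where "w n x = indicator (A n) x * u x" for n x
  have A[measurable]: "A n \<in> sets borel" for n
  proof -
    have "closed (A n)" unfolding A_def by (intro closed_Collect_le continuous_intros)
    then show ?thesis by simp
  qed
  have [measurable]: "u \<in> borel_measurable borel" using L2_measurable[OF u] .
  have w_L2: "w n \<in> L2" for n
    by (rule L2_bound[OF u, of _ 1]) (auto simp: w_def[abs_def] indicator_def)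
  have "(\<lambda>n. LINT x|lborel. (cmod (w n x))\<^sup>2) \<longlonglongrightarrow> integral\<^sup>L lborel (\<lambda>x::real. 0::real)"
  proof (rule integral_dominated_convergence[where w = "\<lambda>x. (cmod (u x))\<^sup>2"])
    show "integrable lborel (\<lambda>x. (cmod (u x))\<^sup>2)" using L2_integrable_square[OF u] .
    show "AE x in lborel. (\<lambda>n. (cmod (w n x))\<^sup>2) \<longlonglongrightarrow> 0"
    proof (rule AE_I2)
      fix x :: real
      have "\<forall>\<^sub>F n in sequentially. \<bar>x\<bar> + R + 1 \<le> \<bar>s n\<bar>"
        using s by (auto simp: filterlim_at_top)
      then have "\<forall>\<^sub>F n in sequentially. (cmod (w n x))\<^sup>2 = 0"
        by eventually_elim (auto simp: w_def A_def)
      then show "(\<lambda>n. (cmod (w n x))\<^sup>2) \<longlonglongrightarrow> 0" by (rule tendsto_eventually)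
    qed
  qed (auto simp: w_def[abs_def] indicator_def)
  then have w_0: "(\<lambda>n. LINT x|lborel. (cmod (w n x))\<^sup>2) \<longlonglongrightarrow> 0" by simp
  have h_L2: "(\<lambda>x. h (x - s n)) \<in> L2" for n
  proof (rule continuous_compact_support_L2)
    show "continuous_on UNIV (\<lambda>x. h (x - s n))"
      by (intro continuous_on_compose2[OF h(1)] continuous_intros) auto
    show "h (x - s n) = 0" if "R + \<bar>s n\<bar> < \<bar>x\<bar>" for x
      using that by (intro h(2)) auto
  qed
  have "(LINT x|lborel. (cmod (h (x - s n)))\<^sup>2) = (LINT x|lborel. (cmod (h x))\<^sup>2)" for n
    using lborel_integral_real_affine[of 1 "\<lambda>x. (cmod (h x))\<^sup>2" "- s n"] by simp
  then have "(\<lambda>n. LINT x|lborel. w n x * h (x - s n)) \<longlonglongrightarrow> 0"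
    by (intro L2_pairing_tendsto_0[OF w_L2 h_L2 w_0, where B = "LINT x|lborel. (cmod (h x))\<^sup>2"]) simp
  moreover have "w n x * h (x - s n) = u x * h (x - s n)" for n x
    using h(2)[of "x - s n"] by (cases "x \<in> A n") (auto simp: w_def A_def)
  ultimately show ?thesis by simp
qed

text \<open>Integrating \<open>u\<close> against its conjugate phase \<open>s\<close> would give the integral of the modulus of \<open>u\<close>.
  The phase is measurable, hence almost everywhere a limit of continuous functions \<open>h n\<close>; cutting these
  off at modulus \<open>1\<close> and multiplying by a tent function \<open>\<kappa>\<close> makes them admissible and dominated.\<close>

lemma L2_eq_0_if_orthogonal_to_continuous:
  assumes u: "u \<in> L2"
    and orth: "\<And>h R. continuous_on UNIV h \<Longrightarrow> (\<And>x. R < \<bar>x\<bar> \<Longrightarrow> h x = 0) \<Longrightarrow>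
      (LINT x|lborel. u x * h x) = 0"
  shows "AE x in lborel. u x = 0"
proof -
  have [measurable]: "u \<in> borel_measurable borel" using L2_measurable[OF u] .
  define s where "s x = cnj (u x) * of_real (inverse (cmod (u x)))" for x
  have us: "u x * s x = of_real (cmod (u x))" for x
    using complex_norm_square[of "u x"]
    by (cases "u x = 0") (auto simp: s_def power2_eq_square field_simps)
  have s_le: "cmod (s x) \<le> 1" for x
    by (cases "u x = 0") (simp_all add: s_def norm_mult norm_inverse)
  have [measurable]: "cnj \<in> borel_measurable borel"
    by (intro borel_measurable_continuous_onI continuous_intros)
  have "s \<in> borel_measurable lborel"
    unfolding s_def[abs_def] by measurable
  then have "s measurable_on UNIV"
    by (intro lebesgue_measurable_imp_measurable_on) (auto intro: measurable_completion)
  then obtain N h where N: "negligible N" and h: "\<And>n. continuous_on UNIV (h n)"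
    and lim: "\<And>x. x \<notin> N \<Longrightarrow> (\<lambda>n. h n x) \<longlonglongrightarrow> s x"
    by (auto simp: measurable_on_def)
  define c where "c n x = h n x / of_real (max 1 (cmod (h n x)))" for n x
  have c: "continuous_on UNIV (c n)" for n
    unfolding c_def[abs_def] by (intro continuous_intros h) auto
  have c_le: "cmod (c n x) \<le> 1" for n x
    by (auto simp: c_def norm_divide divide_simps max_def)
  have c_lim: "(\<lambda>n. c n x) \<longlonglongrightarrow> s x" if "x \<notin> N" for x
  proof -
    have "(\<lambda>n. c n x) \<longlonglongrightarrow> s x / of_real (max 1 (cmod (s x)))"
      unfolding c_def by (intro tendsto_intros lim that) auto
    moreover have "max 1 (cmod (s x)) = 1" using s_le[of x] by simp
    ultimately show ?thesis by simp
  qed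
  have AE_N: "AE x in lborel. x \<notin> N"
    using N by (auto simp: negligible_iff_null_sets AE_completion_iff dest: AE_not_in)
  have "AE x in lborel. cmod (u x) * max 0 (real m - \<bar>x\<bar>) = 0" for m :: nat
  proof -
    define \<kappa> where "\<kappa> x = max 0 (real m - \<bar>x\<bar>)" for x
    have \<kappa>: "continuous_on UNIV \<kappa>" "\<And>x. real m < \<bar>x\<bar> \<Longrightarrow> \<kappa> x = 0" "\<And>x. 0 \<le> \<kappa> x"
      unfolding \<kappa>_def[abs_def] by (auto intro!: continuous_intros)
    have [measurable]: "\<kappa> \<in> borel_measurable borel"
      using \<kappa>(1) by (rule borel_measurable_continuous_onI)
    have "(\<lambda>x. of_real (\<kappa> x)) \<in> L2"
      by (rule continuous_compact_support_L2[of _ m]) (auto intro!: continuous_intros \<kappa>)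
    from integrable_norm[OF L2_mult_integrable[OF u this]]
    have int: "integrable lborel (\<lambda>x. cmod (u x) * \<kappa> x)"
      by (simp add: norm_mult \<kappa>(3))
    have "(\<lambda>n. LINT x|lborel. u x * (of_real (\<kappa> x) * c n x)) \<longlonglongrightarrow>
        (LINT x|lborel. of_real (cmod (u x) * \<kappa> x))"
    proof (rule Bochner_Integration.integral_dominated_convergence[OF _ _ int])
      show "AE x in lborel. (\<lambda>n. u x * (of_real (\<kappa> x) * c n x)) \<longlonglongrightarrow> of_real (cmod (u x) * \<kappa> x)"
        using AE_N
      proof eventually_elim
        case (elim x)
        have "(\<lambda>n. u x * (of_real (\<kappa> x) * c n x)) \<longlonglongrightarrow> u x * (of_real (\<kappa> x) * s x)"
          by (intro tendsto_intros c_lim elim)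
        also have "u x * (of_real (\<kappa> x) * s x) = of_real (cmod (u x) * \<kappa> x)"
          using us[of x] by (simp add: mult.left_commute mult.commute)
        finally show ?case .
      qed
      show "AE x in lborel. norm (u x * (of_real (\<kappa> x) * c n x)) \<le> cmod (u x) * \<kappa> x" for n
        using mult_left_le[OF c_le[of n] \<kappa>(3)] \<kappa>(3)
        by (auto simp: norm_mult intro!: mult_left_mono)
      show "(\<lambda>x. u x * (of_real (\<kappa> x) * c n x)) \<in> borel_measurable lborel" for n
        using borel_measurable_continuous_onI[OF c[of n]] by measurable
    qed measurable
    moreover have "(LINT x|lborel. u x * (of_real (\<kappa> x) * c n x)) = 0" for n
      by (rule orth[of _ m]) (auto intro!: continuous_intros \<kappa> c)
    ultimately have "(LINT x|lborel. of_real (cmod (u x) * \<kappa> x)) = (0::complex)"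
      by (simp add: LIMSEQ_const_iff)
    then have "(LINT x|lborel. cmod (u x) * \<kappa> x) = 0"
      unfolding integral_complex_of_real by (simp only: of_real_eq_0_iff)
    then show ?thesis
      using integral_nonneg_eq_0_iff_AE[OF int] \<kappa>(3) by (simp add: \<kappa>_def)
  qed
  then have "AE x in lborel. \<forall>m::nat. cmod (u x) * max 0 (real m - \<bar>x\<bar>) = 0"
    unfolding AE_all_countable by blast
  then show ?thesis
  proof eventually_elim
    case (elim x)
    obtain m where "\<bar>x\<bar> < real m" using reals_Archimedean2 by blast
    with elim[rule_format, of m] show ?case by simp
  qed
qed

section \<open>Weak solutions of constant coefficient equations\<close>

text \<open>The operator \<open>P(d/dx)\<close>, without the factor \<open>\<i>\<close> of \<open>D\<close>.\<close>

definition diff_op :: "complex poly \<Rightarrow> (real \<Rightarrow> complex) \<Rightarrow> real \<Rightarrow> complex" where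
  "diff_op P f x = (\<Sum>k\<le>degree P. coeff P k * nderiv k f x)"

lemma diff_op_eq:
  assumes "degree P \<le> n"
  shows "diff_op P f x = (\<Sum>k\<le>n. coeff P k * nderiv k f x)"
  unfolding diff_op_def using assms by (intro sum.mono_neutral_left) (auto simp: coeff_eq_0)

lemma diff_op_diff_cmult:
  assumes "f \<in> Ck (degree P)" "g \<in> Ck (degree P)"
  shows "diff_op P (\<lambda>x. f x - c * g x) = (\<lambda>x. diff_op P f x - c * diff_op P g x)"
proof
  fix x
  have "nderiv k (\<lambda>x. f x - c * g x) x = nderiv k f x - c * nderiv k g x" if "k \<le> degree P" for k
    using nderiv_add[OF assms(1) Ck_cmult[OF assms(2), of "- c"] that]
      nderiv_cmult[OF assms(2) that, of "- c"] by simp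
  then have "diff_op P (\<lambda>x. f x - c * g x) x =
      (\<Sum>k\<le>degree P. coeff P k * nderiv k f x - c * (coeff P k * nderiv k g x))"
    unfolding diff_op_def by (intro sum.cong) (simp_all add: right_diff_distrib mult.left_commute)
  then show "diff_op P (\<lambda>x. f x - c * g x) x = diff_op P f x - c * diff_op P g x"
    by (simp add: diff_op_def sum_subtractf sum_distrib_left)
qed

lemma diff_op_linear_factor:
  assumes f': "\<And>x. (f has_vector_derivative f' x) (at x)" and "f \<in> Ck (Suc (degree P))"
    and "f' \<in> Ck (degree P)"
  shows "diff_op ([:- c, 1:] * P) f = diff_op P (\<lambda>x. f' x - c * f x)"
proof
  fix x
  let ?n = "degree P"
  have "degree ([:- c, 1:] * P) \<le> Suc ?n"
    using degree_mult_le[of "[:- c, 1:]" P] by simp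
  from diff_op_eq[OF this] have "diff_op ([:- c, 1:] * P) f x =
      (\<Sum>k\<le>Suc ?n. coeff (pCons 0 P) k * nderiv k f x) - c * (\<Sum>k\<le>Suc ?n. coeff P k * nderiv k f x)"
    by (simp only: mult_pCons_left mult_1_left)
       (simp add: algebra_simps sum.distrib sum_distrib_left sum_subtractf)
  also have "(\<Sum>k\<le>Suc ?n. coeff (pCons 0 P) k * nderiv k f x) = diff_op P f' x"
    unfolding sum.atMost_Suc_shift by (simp add: diff_op_def nderiv_Suc_eq[OF f'])
  also have "(\<Sum>k\<le>Suc ?n. coeff P k * nderiv k f x) = diff_op P f x"
    by (rule diff_op_eq[symmetric]) simp
  also have "diff_op P f' x - c * diff_op P f x = diff_op P (\<lambda>x. f' x - c * f x) x"
    using diff_op_diff_cmult[OF assms(3) Ck_Suc_imp_Ck[OF assms(2)]] by simp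
  finally show "diff_op ([:- c, 1:] * P) f x = diff_op P (\<lambda>x. f' x - c * f x) x" .
qed

lemma diff_op_translate:
  "f \<in> Ck (degree P) \<Longrightarrow> diff_op P (\<lambda>x. f (x - s)) = (\<lambda>x. diff_op P f (x - s))"
  by (auto simp: diff_op_def nderiv_shift fun_eq_iff intro!: sum.cong)

lemma diff_op_continuous: "f \<in> Ck (degree P) \<Longrightarrow> continuous_on UNIV (diff_op P f)"
  unfolding diff_op_def[abs_def] by (intro continuous_intros nderiv_continuous) auto

lemma nderiv_eq_0_outside:
  assumes "\<And>x. R < \<bar>x\<bar> \<Longrightarrow> f x = 0" "R < \<bar>x\<bar>"
  shows "nderiv j f x = 0"
proof (rule nderiv_eq_0_on_open)
  show "open {x::real. R < \<bar>x\<bar>}" by (intro open_Collect_less continuous_intros)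
qed (use assms in auto)

lemma diff_op_eq_0_outside:
  "(\<And>x. R < \<bar>x\<bar> \<Longrightarrow> f x = 0) \<Longrightarrow> R < \<bar>x\<bar> \<Longrightarrow> diff_op P f x = 0"
  using nderiv_eq_0_outside[of R f x] by (simp add: diff_op_def)

lemma diff_op_L2:
  assumes "f \<in> Ck_compact (degree P)"
  shows "diff_op P f \<in> L2"
proof -
  obtain R where "f \<in> Ck (degree P)" "\<And>x. R < \<bar>x\<bar> \<Longrightarrow> f x = 0"
    using assms by (auto simp: Ck_compact_iff)
  then show ?thesis
    using continuous_compact_support_L2[OF diff_op_continuous, of f P R] diff_op_eq_0_outside[of R f _ P]
    by blast
qed

lemma translate_in_Ck_compact:
  fixes f :: "real \<Rightarrow> 'a::real_normed_algebra_1"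
  assumes "f \<in> Ck_compact k"
  shows "(\<lambda>x. f (x - s)) \<in> Ck_compact k"
proof -
  obtain R where f: "f \<in> Ck k" "\<And>x. R < \<bar>x\<bar> \<Longrightarrow> f x = 0"
    using assms by (auto simp: Ck_compact_iff)
  have "\<forall>x. R + \<bar>s\<bar> < \<bar>x\<bar> \<longrightarrow> f (x - s) = 0" by (auto intro!: f(2))
  with Ck_affine[OF f(1), of 1 "- s"] show ?thesis by (auto simp: Ck_compact_iff)
qed

lemma exp_has_vector_derivative:
  "((\<lambda>x. exp (of_real x * c)) has_vector_derivative c * exp (of_real x * c)) (at x)" for c :: complex
proof -
  have "((\<lambda>x. of_real x * c) has_vector_derivative c) (at x)"
    by (auto intro!: derivative_eq_intros)
  from field_vector_diff_chain_at[OF this DERIV_exp] show ?thesis by (simp add: o_def)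
qed

lemma exp_Ck: "(\<lambda>x. exp (of_real x * c) :: complex) \<in> Ck k"
proof (induction k)
  case 0
  then show ?case by (auto simp: Ck_0 intro!: continuous_intros)
next
  case (Suc k)
  show ?case by (rule Ck_SucI[OF exp_has_vector_derivative Ck_cmult[OF Suc.IH]])
qed

text \<open>The operator \<open>d/dx - c\<close> maps functions of compact support onto those with vanishing integral
  against \<open>exp (- c x)\<close>. Translating \<open>\<eta>\<close> by \<open>s\<close> multiplies this integral by \<open>exp (- c s)\<close>, so the
  combination of \<open>\<eta>\<close> and its translate in the conclusion lies in the range. The preimage is explicit:
  with an antiderivative \<open>G\<close> of \<open>\<eta> x exp (- c x)\<close>, it is
  \<open>exp (c (x - s)) (G (x - s) - G x)\<close>, which vanishes far from the origin since \<open>G\<close> is constant on either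
  side of the support of \<open>\<eta>\<close>.\<close>

lemma translate_minus_exp_multiple_in_range:
  fixes \<eta> :: "real \<Rightarrow> complex" and c :: complex
  assumes \<eta>: "\<eta> \<in> Ck_compact k"
  obtains \<zeta> \<zeta>' where "\<zeta> \<in> Ck_compact (Suc k)" "\<And>x. (\<zeta> has_vector_derivative \<zeta>' x) (at x)"
    "\<zeta>' \<in> Ck k" "\<And>x. \<zeta>' x - c * \<zeta> x = \<eta> (x - s) - exp (- (of_real s * c)) * \<eta> x"
proof -
  obtain R where \<eta>: "\<eta> \<in> Ck k" "\<And>x. R < \<bar>x\<bar> \<Longrightarrow> \<eta> x = 0"
    using \<eta> by (auto simp: Ck_compact_iff)
  have w_Ck: "(\<lambda>x. \<eta> x * exp (of_real x * - c)) \<in> Ck k"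
    by (intro Ck_mult \<eta> exp_Ck)
  obtain G where G: "\<And>x. (G has_vector_derivative \<eta> x * exp (of_real x * - c)) (at x)"
    using antiderivative_exists[OF Ck_continuous[OF w_Ck]] by blast
  have G_Ck: "G \<in> Ck (Suc k)" by (rule Ck_SucI[OF G w_Ck])
  define E where "E = exp (- (of_real s * c))"
  define H where "H x = G (x - s) - G x" for x
  define \<zeta> where "\<zeta> x = E * (exp (of_real x * c) * H x)" for x
  have H_Ck: "H \<in> Ck (Suc k)"
    using Ck_affine[OF G_Ck, of 1 "- s"] G_Ck unfolding H_def[abs_def] by (intro Ck_diff) auto
  have "((\<lambda>x. G (x - s)) has_vector_derivative \<eta> (x - s) * exp (of_real (x - s) * - c)) (at x)" for x
  proof -
    have "((\<lambda>x. x - s) has_vector_derivative 1) (at x)"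
      by (auto intro!: derivative_eq_intros)
    from vector_diff_chain_at[OF this G] show ?thesis by (simp add: o_def)
  qed
  then have H': "(H has_vector_derivative
      \<eta> (x - s) * exp (of_real (x - s) * - c) - \<eta> x * exp (of_real x * - c)) (at x)" for x
    unfolding H_def[abs_def] using G by (rule has_vector_derivative_diff)
  define \<zeta>' where "\<zeta>' x = c * \<zeta> x + (\<eta> (x - s) - E * \<eta> x)" for x
  have \<zeta>': "(\<zeta> has_vector_derivative \<zeta>' x) (at x)" for x
  proof -
    have "exp (of_real x * c) * exp (of_real (x - s) * - c) = inverse E"
      "exp (of_real x * c) * exp (of_real x * - c) = 1"
      unfolding E_def by (simp_all add: exp_add[symmetric] exp_minus[symmetric] algebra_simps)
    moreover have "E * inverse E = 1" by (simp add: E_def)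
    ultimately have eq: "E * (exp (of_real x * c) *
        (\<eta> (x - s) * exp (of_real (x - s) * - c) - \<eta> x * exp (of_real x * - c)) +
        c * exp (of_real x * c) * H x) = \<zeta>' x"
      unfolding \<zeta>'_def \<zeta>_def by algebra
    show ?thesis
      unfolding eq[symmetric] \<zeta>_def[abs_def]
      by (intro has_vector_derivative_mult_right has_vector_derivative_mult
          exp_has_vector_derivative H')
  qed
  have \<zeta>_Ck: "\<zeta> \<in> Ck (Suc k)"
    unfolding \<zeta>_def[abs_def] by (intro Ck_cmult Ck_mult exp_Ck H_Ck)
  have \<zeta>'_Ck: "\<zeta>' \<in> Ck k"
    using Ck_affine[OF \<eta>(1), of 1 "- s"] Ck_Suc_imp_Ck[OF \<zeta>_Ck] \<eta>(1)
    unfolding \<zeta>'_def[abs_def] by (intro Ck_add Ck_diff Ck_cmult) auto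
  have G_const: "G x = G y" if "x \<in> S" "y \<in> S" "convex S" "\<And>x. x \<in> S \<Longrightarrow> R < \<bar>x\<bar>" for x y S
  proof -
    have "(G has_vector_derivative 0) (at x within S)" if "x \<in> S" for x
      using has_vector_derivative_at_within[OF G[of x]] \<eta>(2)[of x] that \<open>x \<in> S \<Longrightarrow> R < \<bar>x\<bar>\<close>
      by simp
    then obtain d where "\<And>x. x \<in> S \<Longrightarrow> G x = d"
      using has_vector_derivative_zero_constant[OF \<open>convex S\<close>] by blast
    with that show ?thesis by simp
  qed
  have "\<zeta> x = 0" if "\<bar>R\<bar> + \<bar>s\<bar> < \<bar>x\<bar>" for x
  proof -
    have "G (x - s) = G x"
    proof (cases "x > 0")
      case True
      then show ?thesis using that by (intro G_const[of _ "{\<bar>R\<bar><..}"]) auto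
    next
      case False
      then show ?thesis using that by (intro G_const[of _ "{..<-\<bar>R\<bar>}"]) auto
    qed
    then show ?thesis by (simp add: \<zeta>_def H_def)
  qed
  then have "\<zeta> \<in> Ck_compact (Suc k)" using \<zeta>_Ck by (auto simp: Ck_compact_iff)
  then show ?thesis
    by (rule that[OF _ \<zeta>' \<zeta>'_Ck]) (simp add: \<zeta>'_def E_def)
qed

text \<open>A constant coefficient operator is injective on \<open>L\<^sup>2\<close>. Split off a linear factor, \<open>P = (X - c) P'\<close>,
  and let \<open>T \<eta>\<close> be the integral of \<open>u P'(d/dx) \<eta>\<close>. Since \<open>T\<close> vanishes on the range of
  \<open>d/dx - c\<close>, it turns a translation by \<open>s\<close> into multiplication by \<open>exp (- c s)\<close>, as integration
  against \<open>exp (- c x)\<close> does. Moving the translate to infinity in the direction in which this factor does not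
  decay, and using that \<open>T\<close> of the translates tends to zero, gives \<open>T = 0\<close>. So \<open>u\<close> is also a weak
  solution for \<open>P'\<close>, and after all factors are removed \<open>u\<close> is orthogonal to all continuous functions
  with compact support.\<close>

theorem L2_weak_solution_eq_0:
  assumes u: "u \<in> L2" and "P \<noteq> 0"
    and "\<And>\<eta>. \<eta> \<in> Ck_compact (degree P) \<Longrightarrow> (LINT x|lborel. u x * diff_op P \<eta> x) = 0"
  shows "AE x in lborel. u x = 0"
  using assms(2,3)
proof (induction "degree P" arbitrary: P)
  case 0
  then obtain a where P: "P = [:a:]" "a \<noteq> 0" by (metis degree_0_id pCons_0_0)
  show ?case
  proof (rule L2_eq_0_if_orthogonal_to_continuous[OF u])
    fix h :: "real \<Rightarrow> complex" and R :: real
    assume h: "continuous_on UNIV h" "\<And>x. R < \<bar>x\<bar> \<Longrightarrow> h x = 0"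
    then have "h \<in> Ck_compact 0" by (auto simp: Ck_compact_iff Ck_0)
    then have "0 = (LINT x|lborel. u x * (a * h x))"
      using "0.prems"(2)[of h] P by (simp add: diff_op_def)
    also have "\<dots> = a * (LINT x|lborel. u x * h x)"
      by (simp add: mult.left_commute)
    finally show "(LINT x|lborel. u x * h x) = 0" using P(2) by simp
  qed
next
  case (Suc n)
  then obtain c where "poly P c = 0"
    using fundamental_theorem_of_algebra[of P] by (auto simp: constant_degree)
  then obtain P' where P: "P = [:- c, 1:] * P'" by (auto simp: poly_eq_0_iff_dvd)
  have P'_0: "P' \<noteq> 0" using Suc.prems(1) P by auto
  have deg: "degree P = Suc (degree P')"
    unfolding P using P'_0 by (subst degree_mult_eq) auto
  define T where "T \<eta> = (LINT x|lborel. u x * diff_op P' \<eta> x)" for \<eta>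
  have "T \<eta> = 0" if \<eta>: "\<eta> \<in> Ck_compact (degree P')" for \<eta>
  proof -
    have \<eta>_Ck: "\<eta> \<in> Ck (degree P')" using \<eta> by (simp add: Ck_compact_iff)
    have shift: "T (\<lambda>x. \<eta> (x - s)) = exp (- (of_real s * c)) * T \<eta>" for s
    proof -
      let ?E = "exp (- (of_real s * c))"
      note \<eta>_s = translate_in_Ck_compact[OF \<eta>, of s]
      obtain \<zeta> \<zeta>' where \<zeta>: "\<zeta> \<in> Ck_compact (Suc (degree P'))"
        "\<And>x. (\<zeta> has_vector_derivative \<zeta>' x) (at x)" "\<zeta>' \<in> Ck (degree P')"
        "\<And>x. \<zeta>' x - c * \<zeta> x = \<eta> (x - s) - ?E * \<eta> x"
        by (rule translate_minus_exp_multiple_in_range[OF \<eta>, of c s]) blast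
      have "0 = (LINT x|lborel. u x * diff_op P \<zeta> x)"
        using Suc.prems(2)[of \<zeta>] \<zeta>(1) deg by simp
      also have "diff_op P \<zeta> = diff_op P' (\<lambda>x. \<eta> (x - s) - ?E * \<eta> x)"
        unfolding P using \<zeta>(1) diff_op_linear_factor[OF \<zeta>(2) _ \<zeta>(3)]
        by (simp add: Ck_compact_iff \<zeta>(4))
      also have "\<dots> = (\<lambda>x. diff_op P' (\<lambda>x. \<eta> (x - s)) x - ?E * diff_op P' \<eta> x)"
        using \<eta>_s \<eta>_Ck by (intro diff_op_diff_cmult) (auto simp: Ck_compact_iff)
      also have "(LINT x|lborel. u x * (diff_op P' (\<lambda>x. \<eta> (x - s)) x - ?E * diff_op P' \<eta> x)) =
          (LINT x|lborel. u x * diff_op P' (\<lambda>x. \<eta> (x - s)) x - ?E * (u x * diff_op P' \<eta> x))"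
        by (simp add: algebra_simps)
      also have "\<dots> = T (\<lambda>x. \<eta> (x - s)) - ?E * T \<eta>"
        using L2_mult_integrable[OF u diff_op_L2[OF \<eta>_s]] L2_mult_integrable[OF u diff_op_L2[OF \<eta>]]
        by (simp add: T_def)
      finally show ?thesis by simp
    qed
    \<comment> \<open>The sign of the translations is chosen such that \<open>exp (- s c)\<close> has modulus at least \<open>1\<close>.\<close>
    define s where "s n = (if Re c \<le> 0 then real n else - real n)" for n
    have "(\<lambda>n. \<bar>s n\<bar>) = real" by (auto simp: s_def)
    then have s_lim: "filterlim (\<lambda>n. \<bar>s n\<bar>) at_top sequentially"
      using filterlim_real_sequentially by simp
    obtain R where R: "\<And>x. R < \<bar>x\<bar> \<Longrightarrow> \<eta> x = 0" using \<eta> by (auto simp: Ck_compact_iff)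
    have "(\<lambda>n. T (\<lambda>x. \<eta> (x - s n))) \<longlonglongrightarrow> 0"
      unfolding T_def diff_op_translate[OF \<eta>_Ck]
      by (rule L2_pairing_translate_tendsto_0[OF u diff_op_continuous[OF \<eta>_Ck] diff_op_eq_0_outside[OF R] s_lim])
    then have "(\<lambda>n. cmod (T (\<lambda>x. \<eta> (x - s n)))) \<longlonglongrightarrow> 0"
      by (rule tendsto_norm_zero)
    moreover have "cmod (T \<eta>) \<le> cmod (T (\<lambda>x. \<eta> (x - s n)))" for n
    proof -
      have "0 \<le> - (s n * Re c)" by (auto simp: s_def mult_nonneg_nonpos)
      then have "1 \<le> cmod (exp (- (of_real (s n) * c)))" by simp
      then show ?thesis
        unfolding shift norm_mult by (simp add: mult_le_cancel_right1)
    qed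
    ultimately have "cmod (T \<eta>) \<le> 0"
      by (intro LIMSEQ_le_const) auto
    then show ?thesis by simp
  qed
  with Suc.hyps deg P'_0 show ?case unfolding T_def by auto
qed

section \<open>Integration by parts\<close>

lemma nderiv_L2:
  assumes "f \<in> Ck_compact k" "j \<le> k"
  shows "nderiv j f \<in> L2"
proof -
  obtain R where "f \<in> Ck k" "\<And>x. R < \<bar>x\<bar> \<Longrightarrow> f x = 0"
    using assms by (auto simp: Ck_compact_iff)
  then show ?thesis
    using continuous_compact_support_L2[OF nderiv_continuous[OF _ assms(2)], of f R]
      nderiv_eq_0_outside[of R f _ j] by blast
qed

lemma Ck_compact_mult:
  fixes f w :: "real \<Rightarrow> 'a::real_normed_algebra"
  assumes "w \<in> Ck k" "f \<in> Ck_compact k"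
  shows "(\<lambda>x. w x * f x) \<in> Ck_compact k"
  using assms Ck_mult by (auto simp: Ck_compact_iff) (metis mult_zero_right)

lemma Ck_compact_mono: "f \<in> Ck_compact k \<Longrightarrow> j \<le> k \<Longrightarrow> f \<in> Ck_compact j"
  using Ck_mono by (auto simp: Ck_compact_iff)

lemma nderiv_in_Ck_compact:
  assumes "f \<in> Ck_compact (j + k)"
  shows "nderiv j f \<in> Ck_compact k"
  using assms nderiv_in_Ck[of f j k] nderiv_eq_0_outside[of _ f _ j] unfolding Ck_compact_iff by blast

lemma Ck_compact_L2: "f \<in> Ck_compact k \<Longrightarrow> f \<in> L2"
  using nderiv_L2[of f k 0] by simp

lemma integral_derivative_eq_0:
  fixes G :: "real \<Rightarrow> 'a::euclidean_space"
  assumes "G \<in> Ck_compact 1"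
  shows "(LINT x|lborel. nderiv 1 G x) = 0"
proof -
  obtain R where G: "G \<in> Ck 1" "\<And>x. R < \<bar>x\<bar> \<Longrightarrow> G x = 0"
    using assms by (auto simp: Ck_compact_iff)
  define r where "r = \<bar>R\<bar> + 1"
  have "(LINT x|lborel. indicator {-r..r} x *\<^sub>R nderiv 1 G x) = G r - G (- r)"
  proof (rule integral_FTC_Icc)
    show "- r \<le> r" by (simp add: r_def)
    show "(G has_vector_derivative nderiv 1 G x) (at x within {- r..r})" for x
      using nderiv_has_vector_derivative[OF G(1), of 0 x] by (simp add: has_vector_derivative_at_within)
    show "continuous_on {- r..r} (nderiv 1 G)"
      using nderiv_continuous[OF G(1), of 1] by (auto intro: continuous_on_subset)
  qed
  also have "(\<lambda>x. indicator {-r..r} x *\<^sub>R nderiv 1 G x) = nderiv 1 G"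
  proof
    fix x show "indicator {-r..r} x *\<^sub>R nderiv 1 G x = nderiv 1 G x"
      using nderiv_eq_0_outside[of R G x 1] G(2)
      by (cases "\<bar>x\<bar> \<le> r") (auto simp: indicator_def abs_le_iff r_def)
  qed
  also have "G r - G (- r) = 0" using G(2)[of r] G(2)[of "- r"] by (simp add: r_def)
  finally show ?thesis .
qed

lemma integration_by_parts_1:
  fixes f g :: "real \<Rightarrow> complex"
  assumes "f \<in> Ck_compact 1" "g \<in> Ck_compact 1"
  shows "(LINT x|lborel. nderiv 1 f x * g x) = - (LINT x|lborel. f x * nderiv 1 g x)"
proof -
  have fg: "f \<in> Ck 1" "g \<in> Ck 1" using assms by (auto simp: Ck_compact_iff)
  have "((\<lambda>x. f x * g x) has_vector_derivative f x * nderiv 1 g x + nderiv 1 f x * g x) (at x)" for x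
    using nderiv_has_vector_derivative[OF fg(1), of 0 x] nderiv_has_vector_derivative[OF fg(2), of 0 x]
    by (intro has_vector_derivative_mult) auto
  from nderiv_Suc_eq[OF this, of 0]
  have "nderiv 1 (\<lambda>x. f x * g x) = (\<lambda>x. f x * nderiv 1 g x + nderiv 1 f x * g x)" by simp
  with integral_derivative_eq_0[OF Ck_compact_mult[OF fg(1) assms(2)]]
  have "(LINT x|lborel. f x * nderiv 1 g x + nderiv 1 f x * g x) = 0" by simp
  moreover have "(LINT x|lborel. f x * nderiv 1 g x + nderiv 1 f x * g x) =
      (LINT x|lborel. f x * nderiv 1 g x) + (LINT x|lborel. nderiv 1 f x * g x)"
    by (intro Bochner_Integration.integral_add L2_mult_integrable nderiv_L2[where k = 1] Ck_compact_L2[where k = 1] assms) simp_all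
  ultimately show ?thesis by (simp add: add_eq_0_iff)
qed

lemma integration_by_parts:
  fixes f g :: "real \<Rightarrow> complex"
  assumes "f \<in> Ck_compact j" "g \<in> Ck_compact j"
  shows "(LINT x|lborel. nderiv j f x * g x) = (- 1) ^ j * (LINT x|lborel. f x * nderiv j g x)"
  using assms
proof (induction j arbitrary: g)
  case (Suc j)
  have "nderiv (Suc j) f = nderiv 1 (nderiv j f)" by (simp add: nderiv_def)
  moreover have "nderiv j f \<in> Ck_compact 1" using Suc.prems(1) by (intro nderiv_in_Ck_compact) simp
  moreover have "g \<in> Ck_compact 1" using Suc.prems(2) by (rule Ck_compact_mono) simp
  ultimately have "(LINT x|lborel. nderiv (Suc j) f x * g x) =
      - (LINT x|lborel. nderiv j f x * nderiv 1 g x)"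
    using integration_by_parts_1 by simp
  also have "(LINT x|lborel. nderiv j f x * nderiv 1 g x) =
      (- 1) ^ j * (LINT x|lborel. f x * nderiv j (nderiv 1 g) x)"
    using Suc.prems by (intro Suc.IH nderiv_in_Ck_compact) (auto elim: Ck_compact_mono)
  also have "nderiv j (nderiv 1 g) = nderiv (Suc j) g" by (simp add: nderiv_Suc)
  finally show ?case by simp
qed simp

section \<open>The kernel of the operator\<close>

text \<open>The polynomial \<open>Q(-\<i> x)\<close>: substituting \<open>d/dx\<close> in it gives the transpose \<open>Q(-D)\<close> of \<open>Q(D)\<close> for the
  bilinear pairing.\<close>

definition transpose_symbol :: "real poly \<Rightarrow> complex poly" where
  "transpose_symbol Q = (\<Sum>k\<le>degree Q. monom (of_real (coeff Q k) * (- \<i>) ^ k) k)"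

lemma coeff_transpose_symbol: "coeff (transpose_symbol Q) k = of_real (coeff Q k) * (- \<i>) ^ k"
  by (simp add: transpose_symbol_def coeff_sum coeff_eq_0)

lemma degree_transpose_symbol: "degree (transpose_symbol Q) = degree Q"
proof (rule antisym)
  show "degree (transpose_symbol Q) \<le> degree Q"
    by (rule degree_le) (simp add: coeff_transpose_symbol coeff_eq_0)
  show "degree Q \<le> degree (transpose_symbol Q)"
  proof (cases "Q = 0")
    case False
    then show ?thesis by (intro le_degree) (simp add: coeff_transpose_symbol)
  qed simp
qed

lemma pairing_diff_op_transpose_symbol:
  assumes "u \<in> L2" "\<psi> \<in> Ck_compact (degree Q)"
  shows "(LINT x|lborel. u x * diff_op (transpose_symbol Q) \<psi> x) =
    (\<Sum>k\<le>degree Q. of_real (coeff Q k) * ((- \<i>) ^ k * (LINT x|lborel. u x * nderiv k \<psi> x)))"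
proof -
  have "(LINT x|lborel. u x * diff_op (transpose_symbol Q) \<psi> x) =
      (LINT x|lborel. (\<Sum>k\<le>degree Q. of_real (coeff Q k) * (- \<i>) ^ k * (u x * nderiv k \<psi> x)))"
    by (simp add: diff_op_def degree_transpose_symbol coeff_transpose_symbol sum_distrib_left mult_ac)
  also have "\<dots> = (\<Sum>k\<le>degree Q. LINT x|lborel. of_real (coeff Q k) * (- \<i>) ^ k * (u x * nderiv k \<psi> x))"
    using assms by (intro Bochner_Integration.integral_sum integrable_mult_right L2_mult_integrable nderiv_L2) auto
  finally show ?thesis by (simp add: mult.assoc)
qed

lemma pairing_QD:
  assumes "f \<in> Ck_compact (degree Q)" "\<eta> \<in> Ck_compact (degree Q)"
  shows "(LINT x|lborel. QD Q f x * \<eta> x) = (LINT x|lborel. f x * diff_op (transpose_symbol Q) \<eta> x)"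
proof -
  have "(LINT x|lborel. QD Q f x * \<eta> x) =
      (LINT x|lborel. (\<Sum>k\<le>degree Q. of_real (coeff Q k) * \<i> ^ k * (nderiv k f x * \<eta> x)))"
    by (simp add: QD_def sum_distrib_right mult.assoc)
  also have "\<dots> = (\<Sum>k\<le>degree Q. LINT x|lborel. of_real (coeff Q k) * \<i> ^ k * (nderiv k f x * \<eta> x))"
    using assms by (intro Bochner_Integration.integral_sum integrable_mult_right L2_mult_integrable nderiv_L2 Ck_compact_L2) auto
  also have "\<dots> = (\<Sum>k\<le>degree Q. of_real (coeff Q k) * ((- \<i>) ^ k * (LINT x|lborel. f x * nderiv k \<eta> x)))"
  proof (intro sum.cong refl)
    fix k assume "k \<in> {..degree Q}"
    then have "f \<in> Ck_compact k" "\<eta> \<in> Ck_compact k" using assms by (auto elim: Ck_compact_mono)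
    then have "(LINT x|lborel. nderiv k f x * \<eta> x) = (- 1) ^ k * (LINT x|lborel. f x * nderiv k \<eta> x)"
      by (rule integration_by_parts)
    moreover have "(- \<i>) ^ k = \<i> ^ k * (- 1) ^ k" using power_mult_distrib[of \<i> "- 1" k] by simp
    ultimately show "(LINT x|lborel. of_real (coeff Q k) * \<i> ^ k * (nderiv k f x * \<eta> x)) =
        of_real (coeff Q k) * ((- \<i>) ^ k * (LINT x|lborel. f x * nderiv k \<eta> x))"
      by (simp add: mult.assoc)
  qed
  also have "\<dots> = (LINT x|lborel. f x * diff_op (transpose_symbol Q) \<eta> x)"
    using assms pairing_diff_op_transpose_symbol[OF Ck_compact_L2] by simp
  finally show ?thesis .
qed

lemma QD_in_Ck_compact_0:
  assumes "f \<in> Ck_compact (degree Q)"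
  shows "QD Q f \<in> Ck_compact 0"
proof -
  obtain R where R: "f \<in> Ck (degree Q)" "\<And>x. R < \<bar>x\<bar> \<Longrightarrow> f x = 0"
    using assms by (auto simp: Ck_compact_iff)
  have "continuous_on UNIV (QD Q f)"
    unfolding QD_def[abs_def] using R(1) by (intro continuous_intros nderiv_continuous) auto
  moreover have "QD Q f x = 0" if "R < \<bar>x\<bar>" for x
    using nderiv_eq_0_outside[of R f x] R(2) that by (simp add: QD_def)
  ultimately show ?thesis by (auto simp: Ck_compact_iff Ck_0)
qed

lemma L2_norm_tendsto_0D:
  assumes "(\<lambda>n. L2_norm (f n)) \<longlonglongrightarrow> 0"
  shows "(\<lambda>n. LINT x|lborel. (cmod (f n x))\<^sup>2) \<longlonglongrightarrow> 0"
proof -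
  have "(\<lambda>n. (L2_norm (f n))\<^sup>2) \<longlonglongrightarrow> 0\<^sup>2" using assms by (rule tendsto_power)
  then show ?thesis by (simp add: L2_norm_def)
qed

text \<open>On the graph of \<open>A0 v Q\<close> the weak equation is integration by parts, tested with \<open>\<eta> / v\<close> so that the
  outer factor \<open>v\<close> cancels. Both sides are continuous for \<open>L\<^sup>2\<close> convergence, since the functions they
  are paired with are continuous with compact support.\<close>

lemma closure_kernel_weak_solution:
  assumes v: "v \<in> Ck (degree Q)" "\<And>x. v x \<noteq> 0"
    and g: "(g, \<lambda>x. 0) \<in> op_closure (A0 v Q)" and \<eta>: "\<eta> \<in> Ck_compact (degree Q)"
  shows "(LINT x|lborel. (of_real (v x) * g x) * diff_op (transpose_symbol Q) \<eta> x) = 0"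
proof -
  let ?p = "diff_op (transpose_symbol Q) \<eta>"
  have V: "(\<lambda>x. of_real (v x) :: complex) \<in> Ck (degree Q)" using v(1) by (rule Ck_of_real)
  obtain \<phi> \<psi> where g_L2: "g \<in> L2" and A: "\<And>n. (\<phi> n, \<psi> n) \<in> A0 v Q"
    and \<phi>_lim: "(\<lambda>n. L2_norm (\<lambda>x. \<phi> n x - g x)) \<longlonglongrightarrow> 0"
    and \<psi>_lim: "(\<lambda>n. L2_norm (\<lambda>x. \<psi> n x - 0)) \<longlonglongrightarrow> 0"
    using g unfolding op_closure_def by blast
  have \<phi>: "\<phi> n \<in> Ck_compact (degree Q)"
    and \<psi>: "\<psi> n = (\<lambda>x. of_real (v x) * QD Q (\<lambda>y. of_real (v y) * \<phi> n y) x)" for n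
    using A[of n] by (auto simp: A0_def)
  have V\<phi>: "(\<lambda>x. of_real (v x) * \<phi> n x) \<in> Ck_compact (degree Q)" for n
    using V \<phi> by (rule Ck_compact_mult)
  have p_Ck: "?p \<in> Ck_compact 0"
  proof -
    obtain R where "\<eta> \<in> Ck (degree Q)" "\<And>x. R < \<bar>x\<bar> \<Longrightarrow> \<eta> x = 0"
      using \<eta> by (auto simp: Ck_compact_iff)
    then show ?thesis
      using diff_op_continuous[of \<eta> "transpose_symbol Q"] diff_op_eq_0_outside[of R \<eta> _ "transpose_symbol Q"]
      unfolding Ck_compact_iff Ck_0 degree_transpose_symbol by blast
  qed
  have Vp: "(\<lambda>x. of_real (v x) * ?p x) \<in> L2"
    using Ck_compact_mult[OF Ck_mono[OF V le0] p_Ck] by (rule Ck_compact_L2)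
  have V\<eta>: "(\<lambda>x. inverse (of_real (v x)) * \<eta> x) \<in> L2"
    using v(2) by (intro Ck_compact_L2[OF Ck_compact_mult[OF Ck_inverse[OF V] \<eta>]]) simp
  have "(\<lambda>n. LINT x|lborel. (\<phi> n x - g x) * (of_real (v x) * ?p x)) \<longlonglongrightarrow> 0"
    by (intro L2_pairing_tendsto_0[OF _ Vp _ order_refl] L2_norm_tendsto_0D \<phi>_lim L2_diff
        Ck_compact_L2[OF \<phi>] g_L2)
  moreover have "(LINT x|lborel. (\<phi> n x - g x) * (of_real (v x) * ?p x)) =
      (LINT x|lborel. (of_real (v x) * \<phi> n x) * ?p x) - (LINT x|lborel. (of_real (v x) * g x) * ?p x)" for n
  proof -
    have "(\<lambda>x. (of_real (v x) * h x) * ?p x) = (\<lambda>x. h x * (of_real (v x) * ?p x))" for h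
      by (simp add: mult_ac fun_eq_iff)
    then show ?thesis
      by (simp only: left_diff_distrib Bochner_Integration.integral_diff[OF
          L2_mult_integrable[OF Ck_compact_L2[OF \<phi>[of n]] Vp] L2_mult_integrable[OF g_L2 Vp]])
  qed
  moreover have "(LINT x|lborel. (of_real (v x) * \<phi> n x) * ?p x) =
      (LINT x|lborel. \<psi> n x * (inverse (of_real (v x)) * \<eta> x))" for n
    unfolding pairing_QD[OF V\<phi> \<eta>, symmetric] using v(2) by (simp add: \<psi> field_simps)
  moreover have "(\<lambda>n. LINT x|lborel. \<psi> n x * (inverse (of_real (v x)) * \<eta> x)) \<longlonglongrightarrow> 0"
  proof (rule L2_pairing_tendsto_0[OF _ V\<eta> _ order_refl])
    show "\<psi> n \<in> L2" for n
      unfolding \<psi>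
      by (rule Ck_compact_L2[OF Ck_compact_mult[OF Ck_mono[OF V le0] QD_in_Ck_compact_0[OF V\<phi>]]])
    show "(\<lambda>n. LINT x|lborel. (cmod (\<psi> n x))\<^sup>2) \<longlonglongrightarrow> 0"
      using L2_norm_tendsto_0D[OF \<psi>_lim] by simp
  qed
  ultimately have "(\<lambda>n. LINT x|lborel. \<psi> n x * (inverse (of_real (v x)) * \<eta> x)) \<longlonglongrightarrow>
      0 + (LINT x|lborel. (of_real (v x) * g x) * ?p x)"
    and "(\<lambda>n. LINT x|lborel. \<psi> n x * (inverse (of_real (v x)) * \<eta> x)) \<longlonglongrightarrow> 0"
    using tendsto_add[of _ 0 _ "\<lambda>_. LINT x|lborel. (of_real (v x) * g x) * ?p x"] by fastforce+
  from LIMSEQ_unique[OF this] show ?thesis by simp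
qed

lemma distr_D_power:
  "\<psi> \<in> Ck k \<Longrightarrow> (distr_D ^^ k) T \<psi> = T (\<lambda>x. (- \<i>) ^ k * nderiv k \<psi> x)"
proof (induction k arbitrary: \<psi>)
  case (Suc k)
  have d: "nderiv 1 \<psi> \<in> Ck k" using Suc.prems by (intro nderiv_in_Ck) simp
  have "(distr_D ^^ Suc k) T \<psi> = (distr_D ^^ k) T (\<lambda>x. - \<i> * nderiv 1 \<psi> x)"
    by (simp add: distr_D_def)
  also have "\<dots> = T (\<lambda>x. (- \<i>) ^ k * nderiv k (\<lambda>x. - \<i> * nderiv 1 \<psi> x) x)"
    by (intro Suc.IH Ck_cmult d)
  also have "nderiv k (\<lambda>x. - \<i> * nderiv 1 \<psi> x) = (\<lambda>x. - \<i> * nderiv (Suc k) \<psi> x)"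
    unfolding nderiv_cmult[OF d order_refl] by (simp add: nderiv_Suc)
  finally show ?case by (simp add: mult_ac)
qed simp

lemma distr_QD_distr_of:
  assumes "u \<in> L2" "\<psi> \<in> Ck_compact (degree Q)"
  shows "distr_QD Q (distr_of u) \<psi> = (LINT x|lborel. u x * diff_op (transpose_symbol Q) \<psi> x)"
  unfolding pairing_diff_op_transpose_symbol[OF assms] distr_QD_def
proof (intro sum.cong refl arg_cong2[where f = "(*)"])
  fix k assume "k \<in> {..degree Q}"
  then have "\<psi> \<in> Ck k" using assms(2) Ck_mono by (auto simp: Ck_compact_iff)
  then show "(distr_D ^^ k) (distr_of u) \<psi> = (- \<i>) ^ k * (LINT x|lborel. u x * nderiv k \<psi> x)"
    by (simp add: distr_D_power distr_of_def mult.left_commute[of _ "(- \<i>) ^ k"])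
qed

lemma L2_pairing_uniform_limit:
  assumes u: "u \<in> L2" and L2: "\<And>n. f n \<in> L2" "F \<in> L2"
    and out: "\<And>n x. R < \<bar>x\<bar> \<Longrightarrow> f n x = 0" "\<And>x. R < \<bar>x\<bar> \<Longrightarrow> F x = 0"
    and lim: "uniform_limit {-R..R} f F sequentially"
  shows "(\<lambda>n. LINT x|lborel. u x * f n x) \<longlonglongrightarrow> (LINT x|lborel. u x * F x)"
proof -
  have "(\<lambda>n. LINT x|lborel. (cmod (f n x - F x))\<^sup>2) \<longlonglongrightarrow> 0"
  proof (rule LIMSEQ_I)
    fix e :: real assume e: "0 < e"
    define M where "M = measure lborel {-R..R}"
    have M: "0 \<le> M" by (simp add: M_def)
    \<comment> \<open>With \<open>d \<le> 1\<close>, a difference below \<open>d\<close> also has its square below \<open>d\<close>.\<close>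
    define d where "d = min 1 (e / (M + 1))"
    have d: "0 < d" "d \<le> 1" "d * M < e"
    proof -
      show "0 < d" "d \<le> 1" using e M by (auto simp: d_def)
      have "d * M \<le> e / (M + 1) * M" using M by (intro mult_right_mono) (auto simp: d_def)
      also have "\<dots> < e" using e M by (simp add: field_simps)
      finally show "d * M < e" .
    qed
    obtain n0 where n0: "\<And>n x. n \<ge> n0 \<Longrightarrow> x \<in> {-R..R} \<Longrightarrow> dist (f n x) (F x) < d"
      using uniform_limitD[OF lim d(1)] unfolding eventually_sequentially by blast
    have "(LINT x|lborel. (cmod (f n x - F x))\<^sup>2) < e" if "n \<ge> n0" for n
    proof -
      have "(LINT x|lborel. (cmod (f n x - F x))\<^sup>2) \<le> (LINT x|lborel. d * indicator {-R..R} x)"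
      proof (rule integral_mono)
        show "integrable lborel (\<lambda>x. (cmod (f n x - F x))\<^sup>2)"
          by (intro L2_integrable_square L2_diff L2)
        show "integrable lborel (\<lambda>x. d * indicator {-R..R} x)"
          by (intro integrable_mult_right integrable_real_indicator) (auto simp: emeasure_lborel_Icc_eq)
        fix x
        show "(cmod (f n x - F x))\<^sup>2 \<le> d * indicator {-R..R} x"
        proof (cases "\<bar>x\<bar> \<le> R")
          case True
          then have x: "x \<in> {-R..R}" by auto
          have "cmod (f n x - F x) \<le> d" using n0[OF that x] by (simp add: dist_norm)
          then have "cmod (f n x - F x) * cmod (f n x - F x) \<le> d * 1"
            using d by (intro mult_mono) auto
          then show ?thesis using x by (simp add: power2_eq_square)
        qed (use out[of x] d in simp)
      qed
      also have "\<dots> = d * M" by (simp add: M_def)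
      also have "\<dots> < e" by (rule d)
      finally show ?thesis .
    qed
    then show "\<exists>n0. \<forall>n\<ge>n0. norm ((LINT x|lborel. (cmod (f n x - F x))\<^sup>2) - 0) < e" by auto
  qed
  then have "(\<lambda>n. LINT x|lborel. (f n x - F x) * u x) \<longlonglongrightarrow> 0"
    by (intro L2_pairing_tendsto_0[OF _ u _ order_refl] L2_diff L2)
  moreover have "(LINT x|lborel. (f n x - F x) * u x) =
      (LINT x|lborel. u x * f n x) - (LINT x|lborel. u x * F x)" for n
  proof -
    have "(\<lambda>x. (f n x - F x) * u x) = (\<lambda>x. u x * f n x - u x * F x)"
      by (simp add: fun_eq_iff algebra_simps)
    then show ?thesis
      by (simp only: Bochner_Integration.integral_diff[OF
          L2_mult_integrable[OF u L2(1)[of n]] L2_mult_integrable[OF u L2(2)]])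
  qed
  ultimately show ?thesis by (simp add: LIM_zero_iff)
qed

text \<open>The equation has to be tested with \<open>\<eta> / v\<close>, which is only as smooth as \<open>v\<close> and therefore replaced by
  approximating test functions \<open>\<phi> n\<close> for which all derivatives of \<open>v \<phi> n\<close> up to the degree of \<open>Q\<close> converge
  to those of \<open>\<eta>\<close>, uniformly and with supports in a common interval.\<close>

lemma distr_kernel_weak_solution:
  assumes v: "v \<in> Ck (degree Q)" "\<And>x. v x \<noteq> 0"
    and g: "(g, \<lambda>x. 0) \<in> A_distr v Q" and u: "(\<lambda>x. of_real (v x) * g x) \<in> L2"
    and \<eta>: "\<eta> \<in> Ck_compact (degree Q)"
  shows "(LINT x|lborel. (of_real (v x) * g x) * diff_op (transpose_symbol Q) \<eta> x) = 0"
proof -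
  let ?u = "\<lambda>x. of_real (v x) * g x" and ?V = "\<lambda>x. of_real (v x) :: complex"
  have V: "?V \<in> Ck (degree Q)" using v(1) by (rule Ck_of_real)
  define \<psi> where "\<psi> x = inverse (?V x) * \<eta> x" for x
  have \<psi>: "\<psi> \<in> Ck_compact (degree Q)"
    unfolding \<psi>_def[abs_def] using v(2) by (intro Ck_compact_mult Ck_inverse V \<eta>) simp
  have V\<psi>: "(\<lambda>x. ?V x * \<psi> x) = \<eta>" using v(2) by (simp add: \<psi>_def fun_eq_iff)
  obtain \<phi> R where \<phi>: "\<And>n. \<phi> n \<in> test_fun" and out: "\<And>n x. R < \<bar>x\<bar> \<Longrightarrow> \<phi> n x = 0"
      "\<And>x. R < \<bar>x\<bar> \<Longrightarrow> \<psi> x = 0"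
    and lim: "\<And>j. j \<le> degree Q \<Longrightarrow> uniform_limit {-R..R} (\<lambda>n. nderiv j (\<lambda>x. ?V x * \<phi> n x))
        (nderiv j \<eta>) sequentially"
    using test_fun_dense_Ck_compact[OF \<psi> V] unfolding V\<psi> by blast
  have \<eta>_out: "\<And>x. R < \<bar>x\<bar> \<Longrightarrow> \<eta> x = 0" using out(2) v(2) by (simp add: \<psi>_def)
  have V\<phi>: "(\<lambda>x. ?V x * \<phi> n x) \<in> Ck_compact (degree Q)" for n
    using \<phi>[of n] unfolding test_fun_def by (intro Ck_compact_mult[OF V]) auto
  have "(\<lambda>n. LINT x|lborel. ?u x * diff_op (transpose_symbol Q) (\<lambda>x. ?V x * \<phi> n x) x) \<longlonglongrightarrow>
      (LINT x|lborel. ?u x * diff_op (transpose_symbol Q) \<eta> x)"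
    unfolding pairing_diff_op_transpose_symbol[OF u V\<phi>] pairing_diff_op_transpose_symbol[OF u \<eta>]
  proof (intro tendsto_sum tendsto_mult_left)
    fix k assume "k \<in> {..degree Q}"
    then have k: "k \<le> degree Q" by simp
    show "(\<lambda>n. LINT x|lborel. ?u x * nderiv k (\<lambda>x. ?V x * \<phi> n x) x) \<longlonglongrightarrow>
        (LINT x|lborel. ?u x * nderiv k \<eta> x)"
    proof (rule L2_pairing_uniform_limit[OF u nderiv_L2[OF V\<phi> k] nderiv_L2[OF \<eta> k] _ _ lim[OF k]])
      show "nderiv k (\<lambda>x. ?V x * \<phi> n x) x = 0" if "R < \<bar>x\<bar>" for n x
        using that by (rule nderiv_eq_0_outside[rotated]) (simp add: out(1))
      show "nderiv k \<eta> x = 0" if "R < \<bar>x\<bar>" for x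
        using that by (rule nderiv_eq_0_outside[rotated]) (rule \<eta>_out)
    qed
  qed
  moreover have "(LINT x|lborel. ?u x * diff_op (transpose_symbol Q) (\<lambda>x. ?V x * \<phi> n x) x) = 0" for n
  proof -
    have "distr_mult v (distr_QD Q (distr_of ?u)) (\<phi> n) = distr_of (\<lambda>x. 0) (\<phi> n)"
      using g \<phi>[of n] unfolding A_distr_def by blast
    then show ?thesis
      unfolding distr_mult_def distr_QD_distr_of[OF u V\<phi>] by (simp add: distr_of_def)
  qed
  ultimately show ?thesis by (simp add: LIMSEQ_const_iff)
qed

theorem proposition4p2:
  fixes K :: nat and Q :: "real poly" and v :: "real \<Rightarrow> real" and C :: real
  assumes "K \<ge> 1"
    and "degree Q = K"
    and "v \<in> Ck K"
    and "bounded (range v)"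
    and "\<forall>\<xi>. v \<xi> > 0"
    and "\<forall>\<xi>. \<bar>deriv v \<xi>\<bar> \<le> C * v \<xi>"
  shows "\<not> is_eigenvalue (op_closure (A0 v Q)) 0 \<and> \<not> is_eigenvalue (A_distr v Q) 0"
proof -
  have v: "v \<in> Ck (degree Q)" "\<And>x. v x \<noteq> 0"
    using assms(2,3) spec[OF assms(5)] by (simp_all add: less_imp_neq[symmetric])
  obtain B where B: "\<And>x. \<bar>v x\<bar> \<le> B"
    using assms(4) by (auto simp: bounded_iff)
  have u: "(\<lambda>x. of_real (v x) * g x) \<in> L2" if "g \<in> L2" for g
  proof (rule L2_bound[OF that, of _ B])
    show "(\<lambda>x. of_real (v x) * g x) \<in> borel_measurable borel"
      using L2_measurable[OF that] borel_measurable_continuous_onI[OF Ck_continuous[OF v(1)]]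
      by measurable
    show "cmod (of_real (v x) * g x) \<le> B * cmod (g x)" for x
      using B[of x] by (simp add: norm_mult mult_right_mono)
  qed
  have "transpose_symbol Q \<noteq> 0"
    using degree_transpose_symbol[of Q] assms(1,2) by auto
  have null: "AE x in lborel. g x = 0"
    if g: "g \<in> L2" and weak: "\<And>\<eta>. \<eta> \<in> Ck_compact (degree Q) \<Longrightarrow>
      (LINT x|lborel. (of_real (v x) * g x) * diff_op (transpose_symbol Q) \<eta> x) = 0" for g
  proof -
    have "AE x in lborel. of_real (v x) * g x = 0"
      using weak degree_transpose_symbol[of Q]
      by (intro L2_weak_solution_eq_0[OF u[OF g] \<open>transpose_symbol Q \<noteq> 0\<close>]) simp
    then show ?thesis using v(2) by simp
  qed
  show ?thesis
    unfolding is_eigenvalue_def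
    using null closure_kernel_weak_solution[OF v] distr_kernel_weak_solution[OF v _ u] by auto
qed

end
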